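(* Let $0<\eta<3$ and let $T=\mathrm{co}(V)$ be the triangular pyramid with vertex set $V=\{v_0,v_1,v_2,v_3\}\subset\mathbb{R}^3$ and parameter $\eta$, with circumradius $R_T$. Let $$g = 1024(\eta-3)\rho^3+(-704\eta^2+1920\eta+768)\rho^2+\eta(196\eta^2-732\eta+288)\rho+27\eta^2,$$ and consider the system in $X,Y,\rho$ $$ \begin{aligned} 3(X-Y+1)^2+4\eta X-12X &= 0,\\ 3Y^2-4\rho(3Y-\eta) &= 0,\\ 4\rho\big(4Y-(X-Y-1)^2-\eta X\big)-X(4Y-\eta X) &= 0. \end{aligned}\qquad(\ast) $$ 1. For $0<\eta<\frac{12}{5}$, let $\rho$ be the unique real root of $g$ (as a polynomial in $\rho$), let $O^*=(X,Y,Y,Y)_V$ be the unique solution of $(\ast)$ related to this $\rho$, and let $R^*=\sqrt{\rho}$. Then $R^*>R_T$, $co_{R^*}(V)=V\cup\{O^*\}$, and $O^*\in \mathrm{int}(T)$. 2. For $\frac{12}{5}\le\eta<3$, the solutions $(R^*,O^* )$ (where $R^*=\sqrt\rho$, $\rho$ is a real root of $g$, and $O^*=(X,Y,Y,Y)_V$ with $(X,Y,\rho)$ a real solution of $(\ast)$) are geometrically-admissible but do not yield $R^*$-body configurations for $V$.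
   Context: The triangular pyramid with parameter $\eta\in(0,3)$ is the tetrahedron $T=\mathrm{co}(V)$ in which $v_0$ is at distance $1$ from each of $v_1,v_2,v_3$, and $v_1,v_2,v_3$ form an equilateral triangle of squared edge length $\eta$. $(X_0,X_1,X_2,X_3)_V$ denotes the point of $\mathbb{R}^3$ whose squared Euclidean distances to $v_0,v_1,v_2,v_3$ are $X_0,X_1,X_2,X_3$. For $r>0$, an $r$-body is the complement of a non-empty union of open balls of radius $r$ in $\mathbb{R}^3$; $co_r(V)$, the $r$-hulloid of $V$, is the smallest $r$-body containing $V$. A pair $(R^*,O^* )$ with $O^*=(X,Y,Z,W)_V$ is geometrically-admissible if $X,Y,Z,W,R^*>0$ and there are four spheres $S_0,\dots,S_3$ of radius $R^*$, with $S_j$ containing all $v_i$, $i\ne j$, meeting in $O^*$. An $R^*$-body configuration for $V$ is a quadruple of spheres $S_j=\partial B_j$, $j=0,\dots,3$, boundaries of open balls $B_j$ of radius $R^*$, such that: (i) $S_j$ contains $v_i$ for all $i\neq j$; (ii) $v_j\notin B_j$; (iii) $\bigcap_{j=0}^3 S_j=\{O^*\}$ for a point $O^*$; (iv) $O^*\in\mathrm{int}(T)$.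
   Formalization: In part 2, at η = 12/5 the solution X = 0, Y = 1, ρ = 5/4 (where O* = v_0) is exempted from the claim of geometric admissibility, because that notion requires X > 0; it is still shown to yield no R*-body configuration. *)

theory Defs
  imports "HOL-Analysis.Analysis" "HOL-Computational_Algebra.Polynomial"
begin

text \<open>
  The vertices of a tetrahedron are \<open>v 0, \<dots>, v 3\<close>; the values of \<open>v\<close> at
  other indices are irrelevant.
\<close>

definition triangular_pyramid :: "real \<Rightarrow> (nat \<Rightarrow> real^3) \<Rightarrow> bool" where
  "triangular_pyramid \<eta> v \<longleftrightarrow>
     0 < \<eta> \<and> \<eta> < 3 \<and>
     (\<forall>i\<in>{1..3}. dist (v 0) (v i) = 1) \<and>
     (\<forall>i\<in>{1..3}. \<forall>j\<in>{1..3}. i \<noteq> j \<longrightarrow> (dist (v i) (v j))\<^sup>2 = \<eta>)"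

definition vertices :: "(nat \<Rightarrow> real^3) \<Rightarrow> (real^3) set" where
  "vertices v = v ` {..3}"

text \<open>
  \<open>has_sqdists v P X Y Z W\<close> expresses \<open>P = (X,Y,Z,W)\<^sub>V\<close>. It is a predicate
  because not every quadruple of reals is realised by a point.
\<close>

definition has_sqdists ::
  "(nat \<Rightarrow> real^3) \<Rightarrow> real^3 \<Rightarrow> real \<Rightarrow> real \<Rightarrow> real \<Rightarrow> real \<Rightarrow> bool" where
  "has_sqdists v P X Y Z W \<longleftrightarrow>
     (dist P (v 0))\<^sup>2 = X \<and> (dist P (v 1))\<^sup>2 = Y \<and>
     (dist P (v 2))\<^sup>2 = Z \<and> (dist P (v 3))\<^sup>2 = W"

definition circumradius :: "'a::metric_space set \<Rightarrow> real" where
  "circumradius A = (THE R. \<exists>c. A \<subseteq> sphere c R)"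

definition r_body :: "real \<Rightarrow> 'a::metric_space set \<Rightarrow> bool" where
  "r_body r A \<longleftrightarrow> (\<exists>C. C \<noteq> {} \<and> A = - (\<Union>c\<in>C. ball c r))"

text \<open>
  The smallest \<open>r\<close>-body containing a set, as the intersection of all of them. The lemma
  below shows that it is an \<open>r\<close>-body, hence the least one, whenever one exists.
\<close>

definition r_hulloid :: "real \<Rightarrow> 'a::metric_space set \<Rightarrow> 'a set" where
  "r_hulloid r A = \<Inter> {B. r_body r B \<and> A \<subseteq> B}"

lemma r_hulloid_least:
  assumes "r_body r B" "A \<subseteq> B"
  shows "r_body r (r_hulloid r A)" "A \<subseteq> r_hulloid r A" "r_hulloid r A \<subseteq> B"
proof -
  define C where "C = {c. A \<inter> ball c r = {}}"
  obtain D where D: "D \<noteq> {}" "B = - (\<Union>c\<in>D. ball c r)"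
    using assms(1) unfolding r_body_def by blast
  have "D \<subseteq> C"
    using D(2) assms(2) unfolding C_def by blast
  with D(1) have ne: "C \<noteq> {}" by blast
  have body: "r_body r (- (\<Union>c\<in>C. ball c r))"
    unfolding r_body_def using ne by blast
  have "r_hulloid r A = - (\<Union>c\<in>C. ball c r)"
  proof
    have "A \<subseteq> - (\<Union>c\<in>C. ball c r)"
      unfolding C_def by blast
    with body show "r_hulloid r A \<subseteq> - (\<Union>c\<in>C. ball c r)"
      unfolding r_hulloid_def by blast
    show "- (\<Union>c\<in>C. ball c r) \<subseteq> r_hulloid r A"
      unfolding r_hulloid_def r_body_def C_def by blast
  qed
  with body show "r_body r (r_hulloid r A)" by simp
  show "A \<subseteq> r_hulloid r A" "r_hulloid r A \<subseteq> B"
    using assms unfolding r_hulloid_def by blast+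
qed

text \<open>
  \<open>c j\<close> is the centre of the sphere \<open>S\<^sub>j\<close>. In the first definition the spheres only have
  to share the point \<open>P\<close>; they may have further common points, or coincide.
\<close>

definition geometrically_admissible :: "(nat \<Rightarrow> real^3) \<Rightarrow> real \<Rightarrow> real^3 \<Rightarrow> bool" where
  "geometrically_admissible v R P \<longleftrightarrow>
     (\<exists>X Y Z W. has_sqdists v P X Y Z W \<and> 0 < X \<and> 0 < Y \<and> 0 < Z \<and> 0 < W) \<and> 0 < R \<and>
     (\<exists>c. \<forall>j\<le>3. (\<forall>i\<le>3. i \<noteq> j \<longrightarrow> v i \<in> sphere (c j) R) \<and> P \<in> sphere (c j) R)"

definition body_configuration ::
  "(nat \<Rightarrow> real^3) \<Rightarrow> real \<Rightarrow> real^3 \<Rightarrow> (nat \<Rightarrow> real^3) \<Rightarrow> bool" where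
  "body_configuration v R P c \<longleftrightarrow>
     0 < R \<and>
     (\<forall>j\<le>3. \<forall>i\<le>3. i \<noteq> j \<longrightarrow> v i \<in> sphere (c j) R) \<and>
     (\<forall>j\<le>3. v j \<notin> ball (c j) R) \<and>
     (\<Inter>j\<in>{..3}. sphere (c j) R) = {P} \<and>
     P \<in> interior (convex hull vertices v)"

definition g_poly :: "real \<Rightarrow> real poly" where
  "g_poly \<eta> =
     [: 27 * \<eta>\<^sup>2,
        \<eta> * (196 * \<eta>\<^sup>2 - 732 * \<eta> + 288),
        - 704 * \<eta>\<^sup>2 + 1920 * \<eta> + 768,
        1024 * (\<eta> - 3) :]"

definition pyramid_system :: "real \<Rightarrow> real \<Rightarrow> real \<Rightarrow> real \<Rightarrow> bool" where
  "pyramid_system \<eta> \<rho> X Y \<longleftrightarrow>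
     3 * (X - Y + 1)\<^sup>2 + 4 * \<eta> * X - 12 * X = 0 \<and>
     3 * Y\<^sup>2 - 4 * \<rho> * (3 * Y - \<eta>) = 0 \<and>
     4 * \<rho> * (4 * Y - (X - Y - 1)\<^sup>2 - \<eta> * X) - X * (4 * Y - \<eta> * X) = 0"

end

theory Submission
  imports Defs
begin

text \<open>
  A point with equal distances to the three base vertices lies on the axis of the pyramid, at some
  height \<open>\<tau>\<close> (with \<open>0\<close> at the base and \<open>1\<close> at the apex). In this parameter the system says that the
  sphere through the base and the point, and the spheres through the point, the apex and two base
  vertices, all have squared radius \<open>\<rho>\<close>. Elimination of \<open>\<rho>\<close> leaves the roots of \<open>axial_cubic\<close>, apart
  from the two points \<open>\<tau> = 1\<close> and \<open>\<tau> = - q\<close> in which the axis meets the circumsphere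
  (\<open>axial_solution_cases\<close>). Elimination of \<open>\<tau>\<close> instead produces \<open>g_poly\<close>.

  The axis point is interior to the tetrahedron iff \<open>0 < \<tau> < 1\<close>. The cubic has exactly one positive
  root, and its value at \<open>1\<close> has the sign of \<open>12/5 - \<eta>\<close>. So from \<open>\<eta> = 12/5\<close> on no solution is interior,
  and there is no body configuration, although the four spheres exist. For smaller \<open>\<eta>\<close> the positive
  root is interior. It yields the only solution: \<open>g_poly\<close> has negative discriminant in \<open>\<rho>\<close>
  (\<open>eliminant_root_unique\<close>), the cubic has no negative root (\<open>axial_cubic_root_pos\<close>), and the
  squared circumradius is not a root of \<open>g_poly\<close> (\<open>eliminant_circumsphere_eq_0_iff\<close>).

  The description of the hulloid is not special to pyramids. It holds for every simplex with an interior
  point \<open>P\<close> and spheres of equal radius \<open>R\<close>, each through \<open>P\<close> and all vertices but one, if the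
  circumradius is less than \<open>R\<close> (\<open>hulloid_eq\<close>). The functions \<open>|x - v i|\<^sup>2 - |x - P|\<^sup>2\<close> are affine and,
  up to scaling, are the barycentric coordinates of the simplex of the centres. With them, both
  inclusions become convexity arguments: a ball of radius \<open>R\<close> containing \<open>P\<close> but no vertex would
  have its centre in the simplex of the centres, all of which is closer than \<open>R\<close> to some vertex except for the
  simplex corners (\<open>P_in_hulloid\<close>); and a point of the tetrahedron outside the four balls is a
  vertex or \<open>P\<close> (\<open>hulloid_subset\<close>).
\<close>

section \<open>Hulloids\<close>

lemma mem_r_hulloid_iff:
  "x \<in> r_hulloid r A \<longleftrightarrow> (\<forall>c. (\<forall>a\<in>A. r \<le> dist c a) \<longrightarrow> r \<le> dist c x)"
proof
  assume x: "x \<in> r_hulloid r A"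
  show "\<forall>c. (\<forall>a\<in>A. r \<le> dist c a) \<longrightarrow> r \<le> dist c x"
  proof (intro allI impI)
    fix c assume "\<forall>a\<in>A. r \<le> dist c a"
    moreover have "r_body r (- ball c r)"
      unfolding r_body_def by (rule exI[of _ "{c}"]) simp
    ultimately have "x \<in> - ball c r"
      using x unfolding r_hulloid_def by fastforce
    then show "r \<le> dist c x" by simp
  qed
next
  assume "\<forall>c. (\<forall>a\<in>A. r \<le> dist c a) \<longrightarrow> r \<le> dist c x"
  then show "x \<in> r_hulloid r A"
    unfolding r_hulloid_def r_body_def by (fastforce simp: not_less subset_eq)
qed

text \<open>
  A point outside the convex hull is separated from it by a hyperplane. A ball whose centre is
  moved from the point away from that hyperplane, by slightly less than the radius, contains the
  point and still misses the set.
\<close>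

lemma r_hulloid_subset_convex_hull:
  fixes A :: "'a::euclidean_space set"
  assumes "compact A" "0 < r"
  shows "r_hulloid r A \<subseteq> convex hull A"
proof
  fix x assume x: "x \<in> r_hulloid r A"
  show "x \<in> convex hull A"
  proof (rule ccontr)
    assume nx: "x \<notin> convex hull A"
    have "closed (convex hull A)"
      using assms(1) by (simp add: compact_convex_hull compact_imp_closed)
    from separating_hyperplane_closed_point[OF convex_convex_hull this nx]
    obtain a b where a: "a \<bullet> x < b" and ab: "\<And>p. p \<in> A \<Longrightarrow> b < a \<bullet> p"
      using hull_inc[of _ A convex] by metis
    show False
    proof (cases "a = 0")
      case True
      with ab a have "A = {}" by force
      then have "r \<le> dist x x"
        using x unfolding mem_r_hulloid_iff by blast
      with assms(2) show False by simp
    next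
      case False
      \<comment> \<open>\<open>g\<close> is the width of the separating slab. Moving by \<open>s\<close> along \<open>u\<close> leaves a distance
          of at least \<open>g + s\<close> to the set, so the least \<open>s \<ge> 0\<close> with \<open>r \<le> g + s\<close> is enough.\<close>
      define u where "u = a /\<^sub>R norm a"
      define g where "g = (b - a \<bullet> x) / norm a"
      define s where "s = max 0 (r - g)"
      have u1: "norm u = 1" and g: "0 < g"
        using False a by (simp_all add: u_def g_def)
      have uu: "u \<bullet> u = 1" using u1 by (simp add: norm_eq_1)
      have up: "g \<le> u \<bullet> (p - x)" if "p \<in> A" for p
      proof -
        have "b - a \<bullet> x \<le> a \<bullet> (p - x)"
          using ab[OF that] by (simp add: inner_diff_right)
        then have "g \<le> (a \<bullet> (p - x)) / norm a"
          unfolding g_def by (simp add: divide_right_mono)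
        then show ?thesis by (simp add: u_def divide_inverse mult.commute)
      qed
      have "r \<le> dist (x - s *\<^sub>R u) p" if "p \<in> A" for p
      proof -
        have "r \<le> g + s" by (simp add: s_def)
        also have "\<dots> \<le> u \<bullet> (p - (x - s *\<^sub>R u))"
          using up[OF that] uu by (simp add: inner_diff_right inner_add_right)
        also have "\<dots> \<le> norm u * norm (p - (x - s *\<^sub>R u))"
          by (rule norm_cauchy_schwarz)
        finally show ?thesis using u1 by (simp add: dist_norm norm_minus_commute)
      qed
      then have "r \<le> dist (x - s *\<^sub>R u) x"
        using x unfolding mem_r_hulloid_iff by blast
      also have "\<dots> = s"
        using u1 by (simp add: dist_norm s_def)
      also have "s < r"
        using g assms(2) by (simp add: s_def)
      finally show False by simp
    qed
  qed
qed

section \<open>Squared distances and barycentres\<close>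

text \<open>
  The parallel axis theorem. Arbitrary total weight is allowed, because the weights left over in
  the proof of \<open>hulloid_subset\<close> sum to less than \<open>1\<close>.
\<close>

lemma weighted_sum_sqdist:
  fixes p :: "'i \<Rightarrow> 'a::real_inner"
  shows "(\<Sum>i\<in>I. u i * (dist (p i) z)\<^sup>2) =
    (\<Sum>i\<in>I. u i * (dist (p i) y)\<^sup>2) + 2 * (((\<Sum>i\<in>I. u i *\<^sub>R p i) - sum u I *\<^sub>R y) \<bullet> (y - z))
      + sum u I * (dist y z)\<^sup>2"
proof -
  have "u i * (dist (p i) z)\<^sup>2 = u i * (dist (p i) y)\<^sup>2
      + 2 * ((u i *\<^sub>R p i - u i *\<^sub>R y) \<bullet> (y - z)) + u i * (dist y z)\<^sup>2" for i
    by (simp add: dist_norm power2_norm_eq_inner inner_diff_left inner_diff_right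
        inner_commute algebra_simps)
  then show ?thesis
    by (simp add: sum.distrib sum_distrib_left[symmetric] sum_distrib_right[symmetric]
        inner_sum_left[symmetric] sum_subtractf scaleR_left.sum)
qed

corollary barycentre_sum_sqdist:
  fixes p :: "'i \<Rightarrow> 'a::real_inner"
  assumes "sum u I = 1" "(\<Sum>i\<in>I. u i *\<^sub>R p i) = y"
  shows "(\<Sum>i\<in>I. u i * (dist (p i) z)\<^sup>2) = (\<Sum>i\<in>I. u i * (dist (p i) y)\<^sup>2) + (dist y z)\<^sup>2"
  using weighted_sum_sqdist[of u p z I y] assms by simp

text \<open>
  The points \<open>p\<close> at which the difference of squared distances to \<open>x\<close> and \<open>y\<close> takes a given
  value form a hyperplane orthogonal to \<open>x - y\<close>, unless \<open>x = y\<close>. So coordinates given by squared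
  distances to affinely spanning points determine a point, even up to a common additive constant.
\<close>

lemma eq_if_sqdist_difference_constant:
  fixes x y :: "'a::euclidean_space"
  assumes "affine hull A = UNIV" "\<And>p. p \<in> A \<Longrightarrow> (dist x p)\<^sup>2 - (dist y p)\<^sup>2 = d"
  shows "x = y"
proof -
  define b where "b = ((norm x)\<^sup>2 - (norm y)\<^sup>2 - d) / 2"
  have iff: "(dist x p)\<^sup>2 - (dist y p)\<^sup>2 = d \<longleftrightarrow> (x - y) \<bullet> p = b" for p
    unfolding b_def
    by (auto simp: dist_norm power2_norm_eq_inner inner_diff_left inner_diff_right
        inner_commute field_simps)
  have "A \<subseteq> {p. (x - y) \<bullet> p = b}"
    using assms(2) iff by auto
  then have "affine hull A \<subseteq> {p. (x - y) \<bullet> p = b}"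
    by (rule hull_minimal) (rule affine_hyperplane)
  then have "(dist x p)\<^sup>2 - (dist y p)\<^sup>2 = d" for p
    using assms(1) iff by auto
  from this[of x] this[of y] show ?thesis
    by (simp add: dist_commute)
qed

section \<open>The hulloid of a simplex with spheres through an interior point\<close>

text \<open>
  The dimension-free setting behind an \<open>R\<close>-body configuration: \<open>P\<close> has positive barycentric
  coordinates \<open>w\<close>, and the sphere of radius \<open>R\<close> about \<open>c j\<close> passes through \<open>P\<close> and all vertices
  except \<open>v j\<close>. So in the simplex of the centres, the facet opposite \<open>c i\<close> lies in the
  perpendicular bisector of \<open>P\<close> and \<open>v i\<close>.
\<close>

locale body_simplex =
  fixes I :: "'i set" and v :: "'i \<Rightarrow> 'a::euclidean_space" and P :: 'a
    and w :: "'i \<Rightarrow> real" and c :: "'i \<Rightarrow> 'a" and R :: real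
  assumes finite: "finite I"
    and inj: "inj_on v I"
    and affine_hull: "affine hull (v ` I) = UNIV"
    and w_pos: "i \<in> I \<Longrightarrow> 0 < w i"
    and w_sum: "sum w I = 1"
    and w_bary: "(\<Sum>i\<in>I. w i *\<^sub>R v i) = P"
    and c_P: "j \<in> I \<Longrightarrow> dist (c j) P = R"
    and c_v: "i \<in> I \<Longrightarrow> j \<in> I \<Longrightarrow> i \<noteq> j \<Longrightarrow> dist (c j) (v i) = R"
begin

text \<open>
  The squared length of \<open>x\<close> cancels, so this function is affine in \<open>x\<close>, with the perpendicular
  bisector of \<open>P\<close> and \<open>v i\<close> as its zero set. As \<open>sum_excess\<close> and \<open>excess_centre\<close> show, the functions
  \<open>w i * excess i / total\<close> are the barycentric coordinates of the simplex of the centres \<open>c j\<close>.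
\<close>

definition excess :: "'i \<Rightarrow> 'a \<Rightarrow> real" where
  "excess i x = (dist (v i) x)\<^sup>2 - (dist P x)\<^sup>2"

definition total :: real where
  "total = (\<Sum>i\<in>I. w i * (dist (v i) P)\<^sup>2)"

lemma sum_excess: "(\<Sum>i\<in>I. w i * excess i x) = total"
  using barycentre_sum_sqdist[OF w_sum w_bary, of x]
  by (simp add: excess_def total_def right_diff_distrib sum_subtractf
      sum_distrib_right[symmetric] w_sum)

lemma total_pos: "0 < total"
proof -
  have "\<exists>i\<in>I. v i \<noteq> P"
  proof (rule ccontr)
    assume "\<not> ?thesis"
    then have "x = y" for x y :: 'a
      by (intro eq_if_sqdist_difference_constant[OF affine_hull,
            where d = "(dist x P)\<^sup>2 - (dist y P)\<^sup>2"]) auto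
    then show False
      using vector_choose_size[of 1, where 'a = 'a] by (metis zero_le_one norm_zero zero_neq_one)
  qed
  then obtain i where "i \<in> I" "v i \<noteq> P" by blast
  then have "0 < w i * (dist (v i) P)\<^sup>2" using w_pos by simp
  then show ?thesis
    unfolding total_def
    using finite \<open>i \<in> I\<close> w_pos
    by (intro sum_pos2[of I i]) (simp_all add: less_imp_le)
qed

lemma excess_centre:
  assumes "i \<in> I" "j \<in> I"
  shows "excess i (c j) = (if i = j then total / w j else 0)"
proof -
  have 0: "excess k (c j) = 0" if "k \<in> I" "k \<noteq> j" for k
    using that assms c_P c_v by (simp add: excess_def dist_commute)
  have "(\<Sum>k\<in>I. w k * excess k (c j)) = w j * excess j (c j)"
    using finite assms 0 by (subst sum.remove[of I j]) auto
  then show ?thesis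
    using 0 assms sum_excess[of "c j"] w_pos[OF assms(2)] by (auto simp: field_simps)
qed

lemma vertex_outside_ball:
  assumes "i \<in> I" "j \<in> I"
  shows "R \<le> dist (c j) (v i)"
proof (cases "i = j")
  case True
  have "0 \<le> excess j (c j)"
    using excess_centre[OF assms(2) assms(2)] total_pos w_pos[OF assms(2)] by simp
  then have "dist (c j) P \<le> dist (c j) (v j)"
    by (simp add: excess_def dist_commute)
  then show ?thesis using True c_P[OF assms(2)] by simp
qed (use c_v assms in auto)

lemma excess_affine:
  assumes "sum u I = 1"
  shows "excess i (\<Sum>j\<in>I. u j *\<^sub>R p j) = (\<Sum>j\<in>I. u j * excess i (p j))"
  using barycentre_sum_sqdist[OF assms refl, of p "v i"] barycentre_sum_sqdist[OF assms refl, of p P]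
  by (simp add: excess_def right_diff_distrib sum_subtractf dist_commute)

text \<open>
  Suppose that the ball of radius \<open>R\<close> about \<open>x\<close> contains \<open>P\<close> but none of the vertices. Then all excesses of
  \<open>x\<close> are positive, that is, \<open>x\<close> lies inside the simplex of the centres. Cutting that simplex into
  cones from the circumcentre \<open>Q\<close>, where all excesses agree, puts \<open>x\<close> into the convex hull of \<open>Q\<close> and
  all \<open>c j\<close> with \<open>j \<noteq> i\<close>, where \<open>i\<close> is an index of least excess. These points have distance at most
  \<open>R\<close> from \<open>v i\<close>, and \<open>Q\<close>, which has positive weight, is strictly closer; by convexity \<open>x\<close> is closer
  than \<open>R\<close> to \<open>v i\<close>.
\<close>

lemma P_in_hulloid:
  assumes Q: "\<And>i. i \<in> I \<Longrightarrow> dist Q (v i) = r" and "r < R"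
    and x: "\<And>i. i \<in> I \<Longrightarrow> R \<le> dist x (v i)"
  shows "R \<le> dist x P"
proof (rule ccontr)
  assume "\<not> ?thesis"
  then have xP: "dist x P < R" by simp
  have ne: "I \<noteq> {}" using w_sum by auto
  have R0: "0 \<le> R" using ne c_P by (metis zero_le_dist ex_in_conv)
  have r0: "0 \<le> r" using ne Q by (metis zero_le_dist ex_in_conv)
  define m where "m = Min ((\<lambda>i. excess i x) ` I)"
  have m_le: "m \<le> excess i x" if "i \<in> I" for i
    using that finite by (simp add: m_def)
  have "m \<in> (\<lambda>i. excess i x) ` I"
    unfolding m_def using finite ne by (intro Min_in) auto
  then obtain i where i: "i \<in> I" "m = excess i x" by blast
  have "(dist x P)\<^sup>2 < (dist x (v i))\<^sup>2"
    using xP x[OF i(1)] by (intro power_strict_mono) auto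
  then have m_pos: "0 < m"
    using i(2) by (simp add: excess_def dist_commute)
  have Q_eq: "excess k Q = total" if "k \<in> I" for k
  proof -
    have e: "excess j Q = r\<^sup>2 - (dist P Q)\<^sup>2" if "j \<in> I" for j
      using Q[OF that] by (simp add: excess_def dist_commute)
    have "total = (\<Sum>j\<in>I. w j * (r\<^sup>2 - (dist P Q)\<^sup>2))"
      using sum_excess[of Q] e by (metis (no_types, lifting) sum.cong)
    also have "\<dots> = r\<^sup>2 - (dist P Q)\<^sup>2"
      using w_sum by (simp add: sum_distrib_right[symmetric])
    finally show ?thesis using e[OF that] by simp
  qed
  \<comment> \<open>Barycentric coordinates of \<open>x\<close> with respect to \<open>Q\<close>, stored at the index \<open>i\<close>, and the other centres.
      They are read off from the excesses: \<open>Q\<close> has every excess equal to \<open>total\<close>, and \<open>c j\<close>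
      contributes to the excess \<open>j\<close> only.\<close>
  define u where "u j = (if j = i then m else (excess j x - m) * w j) / total" for j
  define p where "p = c(i := Q)"
  have rest: "(\<Sum>j\<in>I - {i}. (excess j x - m) * w j) = total - m"
  proof -
    have "(\<Sum>j\<in>I - {i}. (excess j x - m) * w j) = (\<Sum>j\<in>I. (excess j x - m) * w j)"
      using finite i by (simp add: sum.remove[of I i])
    also have "\<dots> = (\<Sum>j\<in>I. w j * excess j x) - (\<Sum>j\<in>I. w j) * m"
      unfolding sum_distrib_right by (simp add: algebra_simps sum_subtractf)
    finally show ?thesis by (simp add: sum_excess w_sum)
  qed
  have rest': "(\<Sum>j\<in>I - {i}. u j) = (total - m) / total"
    unfolding rest[symmetric] sum_divide_distrib by (rule sum.cong) (auto simp: u_def)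
  have u_i: "u i = m / total" by (simp add: u_def)
  have u_sum: "sum u I = 1"
    using sum.remove[OF finite i(1), of u] rest' u_i total_pos by (simp add: field_simps)
  have u_nonneg: "0 \<le> u j" if "j \<in> I" for j
    using m_le[OF that] m_pos total_pos w_pos[OF that] by (auto simp: u_def)
  define y where "y = (\<Sum>j\<in>I. u j *\<^sub>R p j)"
  have "excess k y = excess k x" if k: "k \<in> I" for k
  proof -
    have "excess k y = u i * total + (\<Sum>j\<in>I - {i}. u j * excess k (c j))"
      unfolding y_def excess_affine[OF u_sum]
      using finite i by (simp add: sum.remove[of I i] p_def Q_eq[OF k])
    also have "(\<Sum>j\<in>I - {i}. u j * excess k (c j))
        = (\<Sum>j\<in>I - {i}. if j = k then excess k x - m else 0)"
      using k excess_centre total_pos w_pos[OF k]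
      by (intro sum.cong) (auto simp: u_def)
    also have "\<dots> = excess k x - m"
      using k i finite by (simp add: sum.delta)
    finally show ?thesis using u_i total_pos by simp
  qed
  then have "(dist y (v k))\<^sup>2 - (dist x (v k))\<^sup>2 = (dist P y)\<^sup>2 - (dist P x)\<^sup>2" if "k \<in> I" for k
    using that by (simp add: excess_def dist_commute algebra_simps)
  then have yx: "y = x"
    by (intro eq_if_sqdist_difference_constant[OF affine_hull]) auto
  have "(dist x (v i))\<^sup>2 \<le> (\<Sum>j\<in>I. u j * (dist (p j) (v i))\<^sup>2)"
    using barycentre_sum_sqdist[OF u_sum, of p x "v i"] yx u_nonneg
    by (simp add: y_def sum_nonneg)
  also have "\<dots> = u i * r\<^sup>2 + (\<Sum>j\<in>I - {i}. u j * (dist (p j) (v i))\<^sup>2)"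
    using finite i Q by (simp add: sum.remove[of I i] p_def)
  also have "(\<Sum>j\<in>I - {i}. u j * (dist (p j) (v i))\<^sup>2) = (\<Sum>j\<in>I - {i}. u j * R\<^sup>2)"
    using i c_v by (intro sum.cong) (auto simp: p_def)
  also have "\<dots> = (1 - u i) * R\<^sup>2"
    using sum.remove[OF finite i(1), of u] u_sum by (simp add: sum_distrib_right[symmetric])
  also have "u i * r\<^sup>2 + (1 - u i) * R\<^sup>2 = R\<^sup>2 - u i * (R\<^sup>2 - r\<^sup>2)"
    by (simp add: algebra_simps)
  also have "\<dots> < R\<^sup>2"
    using u_i m_pos total_pos power_strict_mono[OF \<open>r < R\<close> r0, of 2] by simp
  finally have "dist x (v i) < R"
    using R0 by (simp add: power_less_imp_less_base)
  with x[OF i(1)] show False by simp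
qed

text \<open>
  The balls about the centres \<open>c j\<close> miss the vertices, so a point \<open>x\<close> of the hulloid avoids them.
  For a convex combination \<open>x\<close> of the vertices with weights \<open>\<alpha>\<close>, this bounds every \<open>\<alpha> j\<close> from below
  by \<open>D * w j / total\<close>, where \<open>D\<close> is the weighted spread of the vertices about \<open>x\<close>. After
  subtraction of these bounds the weights are still nonnegative, but the parallel axis theorem
  makes their spread about \<open>x\<close> nonpositive. So either they vanish, and \<open>x = P\<close>, or \<open>x\<close> is a vertex.
\<close>

lemma hulloid_subset:
  assumes "0 < R"
  shows "r_hulloid R (v ` I) \<subseteq> v ` I \<union> {P}"
proof
  fix x assume x: "x \<in> r_hulloid R (v ` I)"
  have "x \<in> convex hull (v ` I)"
    using x r_hulloid_subset_convex_hull[of "v ` I" R] finite assms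
    by (auto simp: finite_imp_compact)
  then obtain \<beta> where \<beta>: "\<And>y. y \<in> v ` I \<Longrightarrow> 0 \<le> \<beta> y" "sum \<beta> (v ` I) = 1"
      "(\<Sum>y\<in>v ` I. \<beta> y *\<^sub>R y) = x"
    using finite by (auto simp: convex_hull_finite)
  define \<alpha> where "\<alpha> i = \<beta> (v i)" for i
  have \<alpha>: "\<And>i. i \<in> I \<Longrightarrow> 0 \<le> \<alpha> i" "sum \<alpha> I = 1" "(\<Sum>i\<in>I. \<alpha> i *\<^sub>R v i) = x"
    using \<beta> by (simp_all add: \<alpha>_def sum.reindex[OF inj])
  define D where "D = (\<Sum>i\<in>I. \<alpha> i * (dist (v i) x)\<^sup>2)"
  have D: "D * w j \<le> \<alpha> j * total" if j: "j \<in> I" for j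
  proof -
    have "R \<le> dist (c j) x"
      using x vertex_outside_ball[OF _ j] unfolding mem_r_hulloid_iff by blast
    then have "R\<^sup>2 \<le> (dist (c j) x)\<^sup>2" using assms by (intro power_mono) auto
    moreover have "(\<Sum>i\<in>I. \<alpha> i * (dist (v i) (c j))\<^sup>2) = D + (dist x (c j))\<^sup>2"
      unfolding D_def by (rule barycentre_sum_sqdist[OF \<alpha>(2,3)])
    moreover have "(\<Sum>i\<in>I. \<alpha> i * (dist (v i) (c j))\<^sup>2)
        = (\<Sum>i\<in>I. \<alpha> i * R\<^sup>2 + (if i = j then \<alpha> j * (total / w j) else 0))"
    proof (rule sum.cong)
      fix i assume "i \<in> I"
      then have "(dist (v i) (c j))\<^sup>2 = R\<^sup>2 + (if i = j then total / w j else 0)"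
        using excess_centre[of i j] c_P[OF j] j by (simp add: excess_def dist_commute)
      then show "\<alpha> i * (dist (v i) (c j))\<^sup>2 = \<alpha> i * R\<^sup>2 + (if i = j then \<alpha> j * (total / w j) else 0)"
        by (simp add: algebra_simps)
    qed simp
    moreover have "\<dots> = R\<^sup>2 + \<alpha> j * (total / w j)"
      using \<alpha>(2) finite j by (simp add: sum.distrib sum_distrib_right[symmetric])
    ultimately have "D \<le> \<alpha> j * (total / w j)" by (simp add: dist_commute)
    then show ?thesis using w_pos[OF j] by (simp add: field_simps)
  qed
  define \<delta> where "\<delta> j = \<alpha> j - D / total * w j" for j
  have \<delta>_nonneg: "0 \<le> \<delta> j" if "j \<in> I" for j
    using D[OF that] total_pos by (simp add: \<delta>_def field_simps)
  have \<delta>_sum: "sum \<delta> I = 1 - D / total"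
    using \<alpha>(2) w_sum by (simp add: \<delta>_def sum_subtractf sum_distrib_left[symmetric] sum_divide_distrib[symmetric])
  have "0 \<le> D" unfolding D_def using \<alpha>(1) by (auto intro: sum_nonneg)
  then have \<delta>_le: "sum \<delta> I \<le> 1" using \<delta>_sum total_pos by simp
  have \<delta>_bary: "(\<Sum>i\<in>I. \<delta> i *\<^sub>R v i) - sum \<delta> I *\<^sub>R P = x - P"
  proof -
    have "(\<Sum>i\<in>I. \<delta> i *\<^sub>R v i)
        = (\<Sum>i\<in>I. \<alpha> i *\<^sub>R v i) - (D / total) *\<^sub>R (\<Sum>i\<in>I. w i *\<^sub>R v i)"
      by (simp add: \<delta>_def scaleR_diff_left sum_subtractf scaleR_sum_right)
    then have "(\<Sum>i\<in>I. \<delta> i *\<^sub>R v i) = x - (D / total) *\<^sub>R P"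
      by (simp only: \<alpha>(3) w_bary)
    then show ?thesis by (simp add: \<delta>_sum algebra_simps)
  qed
  have "(\<Sum>i\<in>I. \<delta> i * (dist (v i) P)\<^sup>2)
      = (\<Sum>i\<in>I. \<alpha> i * (dist (v i) P)\<^sup>2) - D / total * (\<Sum>i\<in>I. w i * (dist (v i) P)\<^sup>2)"
    by (simp add: \<delta>_def left_diff_distrib sum_subtractf sum_distrib_left mult.assoc)
  then have \<delta>_P: "(\<Sum>i\<in>I. \<delta> i * (dist (v i) P)\<^sup>2) = (dist x P)\<^sup>2"
    using barycentre_sum_sqdist[OF \<alpha>(2,3), of P] total_pos
    unfolding total_def[symmetric] by (simp add: D_def)
  have "(\<Sum>i\<in>I. \<delta> i * (dist (v i) x)\<^sup>2) = (sum \<delta> I - 1) * (dist x P)\<^sup>2"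
    using weighted_sum_sqdist[of \<delta> v x I P] \<delta>_P \<delta>_bary
    by (simp add: dist_norm power2_norm_eq_inner inner_diff_left inner_diff_right
        inner_commute algebra_simps)
  also have "\<dots> \<le> 0" using \<delta>_le by (simp add: mult_nonpos_nonneg)
  finally have "(\<Sum>i\<in>I. \<delta> i * (dist (v i) x)\<^sup>2) \<le> 0" .
  moreover have nonneg: "0 \<le> \<delta> i * (dist (v i) x)\<^sup>2" if "i \<in> I" for i
    using \<delta>_nonneg[OF that] by simp
  ultimately have "(\<Sum>i\<in>I. \<delta> i * (dist (v i) x)\<^sup>2) = 0"
    by (simp add: order_antisym sum_nonneg)
  then have "\<delta> i * (dist (v i) x)\<^sup>2 = 0" if "i \<in> I" for i
    using that nonneg finite by (simp add: sum_nonneg_eq_0_iff)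
  then consider i where "i \<in> I" "v i = x" | "\<And>i. i \<in> I \<Longrightarrow> \<delta> i = 0" by auto
  then show "x \<in> v ` I \<union> {P}"
  proof cases
    case 2
    with \<delta>_bary show ?thesis by simp
  qed blast
qed

theorem hulloid_eq:
  assumes Q: "\<And>i. i \<in> I \<Longrightarrow> dist Q (v i) = r" and "r < R"
  shows "r_hulloid R (v ` I) = v ` I \<union> {P}"
proof
  have "I \<noteq> {}" using w_sum by auto
  then have "0 \<le> r" using Q by (metis zero_le_dist ex_in_conv)
  with \<open>r < R\<close> show "r_hulloid R (v ` I) \<subseteq> v ` I \<union> {P}"
    by (intro hulloid_subset) simp
  show "v ` I \<union> {P} \<subseteq> r_hulloid R (v ` I)"
    using P_in_hulloid[OF Q \<open>r < R\<close>] by (auto simp: mem_r_hulloid_iff)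
qed

end

section \<open>The algebraic system on the axis\<close>

text \<open>
  Squared lengths are measured in units of the squared height \<open>1 / (1 + q)\<close> of the pyramid, where
  \<open>q\<close> is the ratio of the squared circumradius of the base to the squared height, so that
  \<open>\<eta> = 3 * q / (1 + q)\<close>. The squared diameter of the spheres becomes \<open>k\<close>, so that
  \<open>\<rho> = k / (4 * (1 + q))\<close>, and a point on the axis is given by its height \<open>\<tau>\<close>, with \<open>0\<close> at the base
  and \<open>1\<close> at the apex. The circumsphere meets the axis at the heights \<open>1\<close> and \<open>- q\<close>, so \<open>k = (1 + q)\<^sup>2\<close>
  belongs to it. The roots of the cubic are the heights of the other solutions.
\<close>

definition axial_cubic :: "real \<Rightarrow> real \<Rightarrow> real" where
  "axial_cubic q \<tau> = 4 * \<tau>^3 + 2 * q * \<tau>\<^sup>2 + q * \<tau> - q\<^sup>2"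

text \<open>
  The resultant, up to a constant and a power of \<open>q\<close>, of \<open>axial_cubic q\<close> and
  \<open>k * \<tau>\<^sup>2 - (\<tau>\<^sup>2 + q)\<^sup>2\<close> in the variable \<open>\<tau>\<close>; up to scaling it is \<open>g_poly\<close>.
\<close>

definition eliminant :: "real \<Rightarrow> real \<Rightarrow> real" where
  "eliminant q k = - 16 * k^3 + (4 * q\<^sup>2 + 152 * q + 16) * k\<^sup>2
     + q * (- 36 * q\<^sup>2 - 405 * q + 72) * k + 81 * q\<^sup>2 * (1 + q)\<^sup>2"

text \<open>
  The first equation says that the sphere through the base and the axis point at height \<open>\<tau>\<close> has
  the squared radius encoded by \<open>k\<close>; the last one says it of the sphere through this point, the apex
  and two base vertices. At the apex that sphere is not determined, whence the disjunction.
\<close>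

definition axial_solution :: "real \<Rightarrow> real \<Rightarrow> real \<Rightarrow> bool" where
  "axial_solution q k \<tau> \<longleftrightarrow> k * \<tau>\<^sup>2 = (\<tau>\<^sup>2 + q)\<^sup>2 \<and>
     (\<tau> = 1 \<or> q * k = 4 * (q + \<tau>)\<^sup>2 + q * (1 - \<tau>)\<^sup>2)"

lemma poly_g_poly_scaled:
  assumes "0 < q"
  shows "poly (g_poly (3 * q / (1 + q))) (k / (4 * (1 + q))) = 3 * eliminant q k / (1 + q)^4"
proof -
  define u where "u = 1 / (1 + q)"
  have q: "q * u = 1 - u" using assms by (simp add: u_def field_simps)
  have "poly (g_poly (3 * (q * u))) (k * u / 4) = 3 * eliminant q k * u^4"
  proof -
    have "eliminant q k * u^4 = - 16 * (k * u)^3 * u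
        + (4 * (q * u)\<^sup>2 + 152 * (q * u) * u + 16 * u\<^sup>2) * (k * u)\<^sup>2
        + (q * u) * (- 36 * (q * u)\<^sup>2 - 405 * (q * u) * u + 72 * u\<^sup>2) * (k * u)
        + 81 * (q * u)\<^sup>2 * (u + q * u)\<^sup>2"
      by (simp add: eliminant_def power2_eq_square power3_eq_cube power4_eq_xxxx algebra_simps)
    then show ?thesis
      unfolding mult.assoc[of 3] q
      by (simp add: g_poly_def power2_eq_square power3_eq_cube algebra_simps)
  qed
  moreover have "3 * (q * u) = 3 * q / (1 + q)" "k * u / 4 = k / (4 * (1 + q))"
      "3 * eliminant q k * u^4 = 3 * eliminant q k / (1 + q)^4"
    by (simp_all add: u_def power_divide)
  ultimately show ?thesis by (simp only:)
qed

text \<open>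
  The first equation of the system is the one between the squared distances from an axis point to
  the apex and to the base vertices, and hence is solved by a parameter \<open>\<tau>\<close>. The third equation then
  acquires the factor \<open>(1 - \<tau>)\<^sup>2\<close>.
\<close>

lemma pyramid_system_scaled_iff:
  assumes "0 < q"
  shows "pyramid_system (3 * q / (1 + q)) (k / (4 * (1 + q))) X Y \<longleftrightarrow>
    (\<exists>\<tau>. X = (1 - \<tau>)\<^sup>2 / (1 + q) \<and> Y = (\<tau>\<^sup>2 + q) / (1 + q) \<and> axial_solution q k \<tau>)"
    (is "?L \<longleftrightarrow> ?R")
proof -
  define u where "u = 1 / (1 + q)"
  define x where "x = X * (1 + q)"
  define y where "y = Y * (1 + q)"
  have nz: "1 + q \<noteq> 0" and u0: "u \<noteq> 0" and qu: "q * u = 1 - u"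
    using assms by (simp_all add: u_def field_simps)
  have X: "X = x * u" and Y: "Y = y * u"
    using nz by (simp_all add: x_def y_def u_def)
  have \<eta>: "3 * q / (1 + q) = 3 * (1 - u)" and \<rho>: "k / (4 * (1 + q)) = k * u / 4"
    unfolding qu[symmetric] by (simp_all add: u_def)
  have 1: "3 * (X - Y + 1)\<^sup>2 + 4 * (3 * q / (1 + q)) * X - 12 * X
      = 3 * u\<^sup>2 * ((x - y + 1 + q)\<^sup>2 - 4 * x)"
  proof -
    have "X - Y + 1 = (x - y + 1 + q) * u"
      using qu by (simp add: X Y algebra_simps)
    then have "(X - Y + 1)\<^sup>2 = (x - y + 1 + q)\<^sup>2 * u\<^sup>2"
      by (simp add: power_mult_distrib)
    then show ?thesis
      unfolding \<eta> by (simp only:) (simp add: X power2_eq_square algebra_simps)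
  qed
  have 2: "3 * Y\<^sup>2 - 4 * (k / (4 * (1 + q))) * (3 * Y - 3 * q / (1 + q))
      = 3 * u\<^sup>2 * (y\<^sup>2 - k * (y - q))"
  proof -
    have "3 * Y - 3 * q / (1 + q) = 3 * ((y - q) * u)"
      using qu unfolding \<eta> by (simp add: Y algebra_simps)
    then show ?thesis
      unfolding \<rho> by (simp add: Y power2_eq_square algebra_simps)
  qed
  have 3: "4 * (k / (4 * (1 + q))) * (4 * Y - (X - Y - 1)\<^sup>2 - 3 * q / (1 + q) * X)
        - X * (4 * Y - 3 * q / (1 + q) * X)
      = u^3 * (k * (4 * y * (1 + q) - (x - y - 1 - q)\<^sup>2 - 3 * q * x)
          - x * (4 * y * (1 + q) - 3 * q * x))"
  proof -
    have one: "(1 + q) * u = 1" using qu by (simp add: algebra_simps)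
    have "4 * Y = 4 * y * (1 + q) * u\<^sup>2"
      using one by (simp add: Y power2_eq_square mult.assoc)
    moreover have "(X - Y - 1)\<^sup>2 = (x - y - 1 - q)\<^sup>2 * u\<^sup>2"
    proof -
      have "X - Y - 1 = (x - y - 1 - q) * u"
        using qu by (simp add: X Y algebra_simps)
      then show ?thesis by (simp add: power_mult_distrib)
    qed
    moreover have "3 * q / (1 + q) * X = 3 * q * x * u\<^sup>2"
      by (simp add: X u_def power2_eq_square)
    ultimately show ?thesis
      unfolding \<rho> by (simp only:) (simp add: X power2_eq_square power3_eq_cube algebra_simps)
  qed
  have key: "(x - y + 1 + q)\<^sup>2 - 4 * x = 0 \<and> y\<^sup>2 - k * (y - q) = 0 \<and>
      k * (4 * y * (1 + q) - (x - y - 1 - q)\<^sup>2 - 3 * q * x) - x * (4 * y * (1 + q) - 3 * q * x) = 0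
    \<longleftrightarrow> (\<exists>\<tau>. x = (1 - \<tau>)\<^sup>2 \<and> y = \<tau>\<^sup>2 + q \<and> axial_solution q k \<tau>)"
    (is "?e1 \<and> ?e2 \<and> ?e3 \<longleftrightarrow> (\<exists>\<tau>. ?t \<tau>)")
  proof -
    have third: "k * (4 * y * (1 + q) - (x - y - 1 - q)\<^sup>2 - 3 * q * x) - x * (4 * y * (1 + q) - 3 * q * x)
        = (1 - \<tau>)\<^sup>2 * (q * k - (4 * (q + \<tau>)\<^sup>2 + q * (1 - \<tau>)\<^sup>2))"
      if "x = (1 - \<tau>)\<^sup>2" "y = \<tau>\<^sup>2 + q" for \<tau>
      unfolding that by (simp add: power2_eq_square algebra_simps)
    show ?thesis
    proof
      assume e: "?e1 \<and> ?e2 \<and> ?e3"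
      define \<tau> where "\<tau> = 1 - (x - y + 1 + q) / 2"
      have x: "x = (1 - \<tau>)\<^sup>2"
        using e by (simp add: \<tau>_def power_divide)
      have "2 * (1 - \<tau>) = x - y + 1 + q" by (simp add: \<tau>_def)
      then have "y = x + 1 + q - 2 * (1 - \<tau>)" by simp
      then have y: "y = \<tau>\<^sup>2 + q"
        unfolding x by (simp add: power2_eq_square algebra_simps)
      have "?t \<tau>"
        using e x y third[OF x y] by (auto simp: axial_solution_def)
      then show "\<exists>\<tau>. ?t \<tau>" ..
    next
      assume "\<exists>\<tau>. ?t \<tau>"
      then obtain \<tau> where t: "x = (1 - \<tau>)\<^sup>2" "y = \<tau>\<^sup>2 + q" "axial_solution q k \<tau>" by blast
      have "x - y + 1 + q = 2 * (1 - \<tau>)"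
        unfolding t(1,2) by (simp add: power2_eq_square algebra_simps)
      then have ?e1 by (simp only:) (simp add: t(1) power2_eq_square algebra_simps)
      moreover have ?e2 using t(2,3) by (simp add: axial_solution_def)
      moreover have ?e3
        using third[OF t(1,2)] t(3) by (auto simp: axial_solution_def)
      ultimately show "?e1 \<and> ?e2 \<and> ?e3" by blast
    qed
  qed
  have "?L \<longleftrightarrow> (\<exists>\<tau>. x = (1 - \<tau>)\<^sup>2 \<and> y = \<tau>\<^sup>2 + q \<and> axial_solution q k \<tau>)"
    unfolding pyramid_system_def 1 2 3 key[symmetric] using u0 by simp
  then show ?thesis
    using nz by (simp add: x_def y_def eq_divide_eq)
qed

text \<open>
  Away from the apex, elimination of \<open>k\<close> leaves a quartic in \<open>\<tau>\<close>. It is divisible by \<open>\<tau> + q\<close>, because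
  at the antipode of the apex on the circumsphere all four spheres coincide with the circumsphere.
\<close>

lemma axial_solution_cases:
  assumes "0 < q" "axial_solution q k \<tau>"
  obtains "\<tau> = 1" "k = (1 + q)\<^sup>2" | "\<tau> = - q" "k = (1 + q)\<^sup>2" | "axial_cubic q \<tau> = 0"
proof (cases "\<tau> = 1")
  case True
  then show ?thesis using assms(2) that(1) by (simp add: axial_solution_def)
next
  case False
  with assms(2) have k: "k * \<tau>\<^sup>2 = (\<tau>\<^sup>2 + q)\<^sup>2" "q * k = 4 * (q + \<tau>)\<^sup>2 + q * (1 - \<tau>)\<^sup>2"
    by (auto simp: axial_solution_def)
  have "(4 * (q + \<tau>)\<^sup>2 + q * (1 - \<tau>)\<^sup>2) * \<tau>\<^sup>2 = q * (\<tau>\<^sup>2 + q)\<^sup>2"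
    unfolding k(2)[symmetric] k(1)[symmetric] by simp
  then have "(\<tau> + q) * axial_cubic q \<tau> = 0"
    unfolding axial_cubic_def by (simp add: power2_eq_square power3_eq_cube algebra_simps)
  then consider "\<tau> = - q" | "axial_cubic q \<tau> = 0" by (auto simp: eq_neg_iff_add_eq_0)
  then show ?thesis
  proof cases
    case 1
    with k(2) have "q * k = q * (1 + q)\<^sup>2" by simp
    with 1 assms(1) that(2) show ?thesis by simp
  qed (rule that(3))
qed

lemma axial_cubic_zero_imp_solution:
  assumes "0 < q" "axial_cubic q \<tau> = 0"
  shows "axial_solution q ((\<tau>\<^sup>2 + q)\<^sup>2 / \<tau>\<^sup>2) \<tau>"
proof -
  have nz: "\<tau> \<noteq> 0" using assms by (auto simp: axial_cubic_def)
  have "q * (\<tau>\<^sup>2 + q)\<^sup>2 + (\<tau> + q) * axial_cubic q \<tau> = (4 * (q + \<tau>)\<^sup>2 + q * (1 - \<tau>)\<^sup>2) * \<tau>\<^sup>2"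
    unfolding axial_cubic_def by (simp add: power2_eq_square power3_eq_cube algebra_simps)
  then show "axial_solution q ((\<tau>\<^sup>2 + q)\<^sup>2 / \<tau>\<^sup>2) \<tau>"
    using nz assms(2) by (simp add: axial_solution_def eq_divide_eq)
qed

text \<open>
  The two axis points of the circumsphere are thus compatible with the eliminant only for
  \<open>q = 4\<close>, that is, \<open>\<eta> = 12/5\<close>.
\<close>

lemma eliminant_circumsphere:
  "eliminant q ((1 + q)\<^sup>2) = 12 * q * (4 - q) * (q\<^sup>2 - q + 4) * (1 + q)\<^sup>2"
  unfolding eliminant_def by (simp add: eval_nat_numeral algebra_simps)

lemma eliminant_circumsphere_eq_0_iff:
  assumes "0 < q"
  shows "eliminant q ((1 + q)\<^sup>2) = 0 \<longleftrightarrow> q = 4"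
proof -
  have "q\<^sup>2 - q + 4 = (q - 1/2)\<^sup>2 + 15/4"
    by (simp add: power2_eq_square algebra_simps)
  moreover have "0 \<le> (q - 1/2)\<^sup>2" by simp
  ultimately have "0 < q\<^sup>2 - q + 4" by linarith
  then show ?thesis
    using assms by (auto simp: eliminant_circumsphere)
qed

lemma eliminant_at_cubic_root:
  assumes "axial_cubic q \<tau> = 0" "\<tau> \<noteq> 0"
  shows "eliminant q ((\<tau>\<^sup>2 + q)\<^sup>2 / \<tau>\<^sup>2) = 0"
proof -
  define k where "k = (\<tau>\<^sup>2 + q)\<^sup>2 / \<tau>\<^sup>2"
  define K where "K = k * \<tau>\<^sup>2"
  have K: "K = (\<tau>\<^sup>2 + q)\<^sup>2" using assms(2) by (simp add: K_def k_def)
  have "\<tau>^6 * eliminant q k = - 16 * K^3 + (4 * q\<^sup>2 + 152 * q + 16) * (K\<^sup>2 * \<tau>\<^sup>2)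
     + q * (- 36 * q\<^sup>2 - 405 * q + 72) * (K * \<tau>^4) + 81 * q\<^sup>2 * (1 + q)\<^sup>2 * \<tau>^6"
    unfolding K_def eliminant_def by (simp add: eval_nat_numeral algebra_simps)
  \<comment> \<open>The cofactor is the quotient of a polynomial division by the cubic.\<close>
  also have "\<dots> = axial_cubic q \<tau> *
      (- 4 * \<tau>^9 + 2 * q * \<tau>^8 + (15 * q + 4) * \<tau>^7 - (9 * q\<^sup>2 + 2 * q) * \<tau>^6
       + (33 * q - 12 * q\<^sup>2) * \<tau>^5 + (12 * q^3 - 15 * q\<^sup>2) * \<tau>^4 + (72 * q\<^sup>2 - 4 * q^3) * \<tau>^3
       - (4 * q^4 + 24 * q^3) * \<tau>\<^sup>2 + 16 * q^3 * \<tau> + 16 * q^4)"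
    unfolding K axial_cubic_def by (simp add: eval_nat_numeral algebra_simps)
  finally show ?thesis
    using assms by (simp add: k_def)
qed

text \<open>
  If a real cubic has two distinct real roots, its third root is real as well, and the
  discriminant is the square of a real number.
\<close>

lemma cubic_root_unique_if_discriminant_neg:
  fixes a b c d x y :: real
  assumes "a \<noteq> 0"
    and x: "a * x^3 + b * x\<^sup>2 + c * x + d = 0" and y: "a * y^3 + b * y\<^sup>2 + c * y + d = 0"
    and disc: "18 * a * b * c * d - 4 * b^3 * d + b\<^sup>2 * c\<^sup>2 - 4 * a * c^3 - 27 * a\<^sup>2 * d\<^sup>2 < 0"
  shows "x = y"
proof (rule ccontr)
  assume "x \<noteq> y"
  define z where "z = - b / a - x - y"
  have b: "b = - a * (x + y + z)" using assms(1) by (simp add: z_def field_simps)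
  have "(x - y) * (a * (x\<^sup>2 + x * y + y\<^sup>2) + b * (x + y) + c) = 0"
    using x y by (simp add: power2_eq_square power3_eq_cube algebra_simps)
  then have c0: "a * (x\<^sup>2 + x * y + y\<^sup>2) + b * (x + y) + c = 0"
    using \<open>x \<noteq> y\<close> by simp
  have c: "c = a * (x * y + y * z + z * x)"
    using c0 unfolding b by (simp add: power2_eq_square algebra_simps)
  have d: "d = - a * x * y * z"
    using x unfolding b c by (simp add: power2_eq_square power3_eq_cube algebra_simps)
  have "18 * a * b * c * d - 4 * b^3 * d + b\<^sup>2 * c\<^sup>2 - 4 * a * c^3 - 27 * a\<^sup>2 * d\<^sup>2
      = (a\<^sup>2 * ((x - y) * (y - z) * (z - x)))\<^sup>2"
    unfolding b c d by (simp add: eval_nat_numeral algebra_simps)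
  with disc show False by (metis not_less zero_le_power2)
qed

text \<open>
  The discriminant of the eliminant vanishes doubly at \<open>q = 4\<close> and is negative between \<open>0\<close> and \<open>4\<close>.
\<close>

lemma eliminant_root_unique:
  assumes "0 < q" "q < 4" "eliminant q k = 0" "eliminant q k' = 0"
  shows "k = k'"
proof -
  let ?a = "- 16 :: real" and ?b = "4 * q\<^sup>2 + 152 * q + 16"
  let ?c = "q * (- 36 * q\<^sup>2 - 405 * q + 72)" and ?d = "81 * q\<^sup>2 * (1 + q)\<^sup>2"
  have "18 * ?a * ?b * ?c * ?d - 4 * ?b^3 * ?d + ?b\<^sup>2 * ?c\<^sup>2 - 4 * ?a * ?c^3 - 27 * ?a\<^sup>2 * ?d\<^sup>2
      = 1296 * q^3 * (4 - q)\<^sup>2 * (8 * q^4 - 463 * q^3 + 8916 * q\<^sup>2 - 57040 * q - 1600)"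
    by (simp add: eval_nat_numeral algebra_simps)
  moreover have "8 * q^4 - 463 * q^3 + 8916 * q\<^sup>2 - 57040 * q - 1600 < 0"
  proof -
    \<comment> \<open>On \<open>(0, 4)\<close> the linear term dominates: \<open>8 * 64 + 8916 * 4 < 57040\<close>.\<close>
    have "q\<^sup>2 \<le> 4 * q" using assms by (simp add: power2_eq_square)
    moreover have "q^4 \<le> 64 * q"
    proof -
      have "q^3 \<le> 4^3" using assms by (intro power_mono) auto
      then have "q^3 * q \<le> 64 * q" using assms by (intro mult_right_mono) auto
      then show ?thesis by (simp add: eval_nat_numeral)
    qed
    moreover have "0 < q^3" using assms by simp
    ultimately show ?thesis using assms by linarith
  qed
  ultimately have "18 * ?a * ?b * ?c * ?d - 4 * ?b^3 * ?d + ?b\<^sup>2 * ?c\<^sup>2 - 4 * ?a * ?c^3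
      - 27 * ?a\<^sup>2 * ?d\<^sup>2 < 0"
    using assms by (simp add: mult_pos_neg)
  from cubic_root_unique_if_discriminant_neg[OF _ _ _ this, of k k'] show ?thesis
    using assms(3,4) by (simp add: eliminant_def)
qed

lemma axial_cubic_strict_mono:
  assumes "0 < q" "0 \<le> \<tau>" "\<tau> < \<tau>'"
  shows "axial_cubic q \<tau> < axial_cubic q \<tau>'"
proof -
  have "4 * \<tau>^3 \<le> 4 * \<tau>'^3" "2 * q * \<tau>\<^sup>2 \<le> 2 * q * \<tau>'\<^sup>2" "q * \<tau> < q * \<tau>'"
    using assms by (auto intro!: power_mono)
  then show ?thesis unfolding axial_cubic_def by linarith
qed

text \<open>
  The sign of \<open>4 - q\<close>, that is, of \<open>12/5 - \<eta>\<close>, decides on which side of the apex the positive root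
  of the cubic lies.
\<close>

lemma axial_cubic_at_1: "axial_cubic q 1 = (4 - q) * (1 + q)"
  by (simp add: axial_cubic_def power2_eq_square algebra_simps)

lemma axial_cubic_positive_root:
  assumes "0 < q"
  obtains \<tau> where "0 < \<tau>" "\<tau> < q" "axial_cubic q \<tau> = 0"
proof -
  have "continuous_on {0..q} (axial_cubic q)"
    unfolding axial_cubic_def by (intro continuous_intros)
  moreover have lo: "axial_cubic q 0 < 0" using assms by (simp add: axial_cubic_def)
  moreover have hi: "axial_cubic q q > 0"
    using assms by (simp add: axial_cubic_def power2_eq_square power3_eq_cube)
  ultimately obtain \<tau> where "0 \<le> \<tau>" "\<tau> \<le> q" "axial_cubic q \<tau> = 0"
    using IVT'[of "axial_cubic q" 0 0 q] assms by force
  with lo hi that show ?thesis by (metis less_eq_real_def less_irrefl)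
qed

text \<open>
  With \<open>u = - \<tau>\<close> the negated cubic is a monic quadratic in \<open>q\<close> with coefficients depending on \<open>u\<close>. These
  are nonnegative up to \<open>u = 1/2\<close>. Then the discriminant is negative until the vertex reaches \<open>4\<close>, and
  from there on the quadratic decreases on \<open>[0, 4]\<close> to a positive value at \<open>q = 4\<close>.
\<close>

lemma axial_cubic_root_pos:
  assumes "0 < q" "q < 4" "axial_cubic q \<tau> = 0"
  shows "0 < \<tau>"
proof (rule ccontr)
  assume "\<not> 0 < \<tau>"
  define u where "u = - \<tau>"
  have u: "0 \<le> u" using \<open>\<not> 0 < \<tau>\<close> by (simp add: u_def)
  have f: "q\<^sup>2 + 4 * u^3 + q * (u - 2 * u\<^sup>2) = 0"
    using assms(3) by (simp add: axial_cubic_def u_def power2_eq_square power3_eq_cube algebra_simps)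
  have u2: "u - 2 * u\<^sup>2 < 0"
  proof (rule ccontr)
    assume "\<not> ?thesis"
    then have "0 \<le> q * (u - 2 * u\<^sup>2)" using assms(1) by simp
    moreover have "0 < q\<^sup>2" "0 \<le> 4 * u^3" using assms(1) u by auto
    ultimately show False using f by linarith
  qed
  then have "u * (1 - 2 * u) < 0" by (simp add: power2_eq_square algebra_simps)
  then have u_half: "1/2 < u" using u by (simp add: mult_less_0_iff)
  show False
  \<comment> \<open>The vertex of the quadratic is at \<open>q = (2 * u\<^sup>2 - u) / 2\<close>, which is compared with \<open>4\<close>.\<close>
  proof (cases "2 * u\<^sup>2 - u < 8")
    case True
    have "u < 5/2"
    proof (rule ccontr)
      assume "\<not> ?thesis"
      then have "2 * u\<^sup>2 - u \<ge> 2 * ((5/2) * u) - u" by (simp add: power2_eq_square)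
      with True \<open>\<not> u < 5/2\<close> show False by simp
    qed
    then have "(u - 1/2) * (5/2 - u) > 0" using u_half by simp
    moreover have "(u - 1/2) * (5/2 - u) = 3 * u - 5/4 - u\<^sup>2"
      by (simp add: power2_eq_square field_simps)
    ultimately have "u\<^sup>2 < 3 * u - 5/4" by simp
    then have "0 < 20 * u - 1 - 4 * u\<^sup>2" using u_half by linarith
    then have "u\<^sup>2 * (20 * u - 1 - 4 * u\<^sup>2) > 0"
      using u_half by simp
    moreover have "4 * (q\<^sup>2 + 4 * u^3 + q * (u - 2 * u\<^sup>2))
        = (2 * q + u - 2 * u\<^sup>2)\<^sup>2 + u\<^sup>2 * (20 * u - 1 - 4 * u\<^sup>2)"
      by (simp add: power2_eq_square power3_eq_cube algebra_simps)
    ultimately show False using f by (smt (verit) zero_le_power2)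
  next
    case False
    have "q\<^sup>2 + 4 * u^3 + q * (u - 2 * u\<^sup>2)
        = (4 - q) * (2 * u\<^sup>2 - u - q - 4) + 4 * (u * (u - 1)\<^sup>2 + 4)"
      by (simp add: power2_eq_square power3_eq_cube algebra_simps)
    moreover have "0 \<le> (4 - q) * (2 * u\<^sup>2 - u - q - 4)"
      using False assms by simp
    moreover have "0 < u * (u - 1)\<^sup>2 + 4" using u by (simp add: add_nonneg_pos)
    ultimately show False using f by simp
  qed
qed

section \<open>Geometry of the triangular pyramid\<close>

locale pyramid =
  fixes q :: real and v :: "nat \<Rightarrow> real^3"
  assumes q_pos: "0 < q"
    and pyramid: "triangular_pyramid (3 * q / (1 + q)) v"
begin

definition base :: "real^3" where
  "base = (1/3) *\<^sub>R (\<Sum>i\<in>{1..3}. v i)"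

definition axis :: "real^3" where
  "axis = v 0 - base"

definition spoke :: "nat \<Rightarrow> real^3" where
  "spoke i = v i - base"

lemma sum_spoke: "(\<Sum>i\<in>{1..3}. spoke i) = 0"
  by (simp add: spoke_def sum_subtractf base_def scaleR_scaleR[symmetric] del: scaleR_scaleR)

lemma edge_sqdist:
  assumes "i \<in> {1..3}" "j \<in> {1..3}" "i \<noteq> j"
  shows "(spoke i - spoke j) \<bullet> (spoke i - spoke j) = 3 * q / (1 + q)"
  using pyramid assms
  by (simp add: triangular_pyramid_def spoke_def dist_norm power2_norm_eq_inner)

text \<open>
  The spokes sum to zero, so summing the squared edge lengths at one base vertex gives three times
  the squared length of its spoke plus the sum \<open>T\<close> of all of them. Hence the spokes have equal length.
\<close>

lemma spoke_spoke_same: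
  assumes i: "i \<in> {1..3}"
  shows "spoke i \<bullet> spoke i = q / (1 + q)"
proof -
  define T where "T = (\<Sum>j\<in>{1..3}. spoke j \<bullet> spoke j)"
  have *: "3 * (spoke i \<bullet> spoke i) + T = 2 * (3 * q / (1 + q))" if i: "i \<in> {1..3}" for i
  proof -
    have "(\<Sum>j\<in>{1..3}. (spoke i - spoke j) \<bullet> (spoke i - spoke j))
        = (\<Sum>j\<in>{1..3} - {i}. 3 * q / (1 + q))"
      using i edge_sqdist by (subst sum.remove[of _ i]) auto
    also have "\<dots> = 2 * (3 * q / (1 + q))" using i by simp
    also have "(\<Sum>j\<in>{1..3}. (spoke i - spoke j) \<bullet> (spoke i - spoke j))
        = (\<Sum>j\<in>{1..3}. spoke i \<bullet> spoke i + spoke j \<bullet> spoke j - 2 * (spoke i \<bullet> spoke j))"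
      by (simp add: inner_diff_left inner_diff_right inner_commute)
    also have "\<dots> = 3 * (spoke i \<bullet> spoke i) + T - 2 * (spoke i \<bullet> (\<Sum>j\<in>{1..3}. spoke j))"
      by (simp add: sum_subtractf sum.distrib T_def inner_sum_right sum_distrib_left)
    finally show ?thesis by (simp only: sum_spoke inner_zero_right)
  qed
  have "(\<Sum>i\<in>{1..3::nat}. 3 * (spoke i \<bullet> spoke i) + T) = (\<Sum>i\<in>{1..3::nat}. 2 * (3 * q / (1 + q)))"
    using * by (intro sum.cong) auto
  then have "3 * T + 3 * T = 6 * (3 * q / (1 + q))"
    by (simp add: sum.distrib sum_distrib_left[symmetric] T_def)
  with *[OF i] show ?thesis by (simp add: field_simps)
qed

lemma spoke_spoke:
  assumes "i \<in> {1..3}" "j \<in> {1..3}"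
  shows "spoke i \<bullet> spoke j = (if i = j then 1 else - 1/2) * (q / (1 + q))"
proof (cases "i = j")
  case False
  have "spoke i \<bullet> spoke i + spoke j \<bullet> spoke j - 2 * (spoke i \<bullet> spoke j) = 3 * (q / (1 + q))"
    using edge_sqdist[OF assms False]
    by (simp add: inner_diff_left inner_diff_right inner_commute)
  then have "spoke i \<bullet> spoke j = - 1/2 * (q / (1 + q))"
    unfolding assms[THEN spoke_spoke_same] by linarith
  with False show ?thesis by simp
qed (use spoke_spoke_same assms in simp)

text \<open>
  All base vertices have distance \<open>1\<close> from the apex, so the axis has the same inner product with every
  spoke. These inner products sum to zero.
\<close>

lemma axis_axis: "axis \<bullet> axis = 1 / (1 + q)"
  and axis_spoke: "i \<in> {1..3} \<Longrightarrow> axis \<bullet> spoke i = 0"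
proof -
  have *: "2 * (axis \<bullet> spoke i) = axis \<bullet> axis - 1 / (1 + q)" if i: "i \<in> {1..3}" for i
  proof -
    have "(axis - spoke i) \<bullet> (axis - spoke i) = 1"
      using pyramid i
      by (simp add: triangular_pyramid_def axis_def spoke_def dist_norm norm_eq_1)
    then show ?thesis
      using spoke_spoke_same[OF i] q_pos
      by (simp add: inner_diff_left inner_diff_right inner_commute field_simps)
  qed
  have "0 = 2 * (axis \<bullet> (\<Sum>i\<in>{1..3}. spoke i))" by (simp only: sum_spoke) simp
  also have "\<dots> = (\<Sum>i\<in>{1..3}. 2 * (axis \<bullet> spoke i))"
    by (simp add: inner_sum_right sum_distrib_left)
  also have "\<dots> = (\<Sum>i\<in>{1..3::nat}. axis \<bullet> axis - 1 / (1 + q))"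
    using * by (intro sum.cong) auto
  finally show a: "axis \<bullet> axis = 1 / (1 + q)" by simp
  show "axis \<bullet> spoke i = 0" if "i \<in> {1..3}" using *[OF that] a by simp
qed

lemma v_0: "v 0 = base + axis"
  and v_spoke: "v i = base + spoke i"
  by (simp_all add: axis_def spoke_def)

lemma atMost_3: "{..3} = insert 0 {1..3::nat}"
  by auto

lemma index_cases:
  assumes "i \<le> (3::nat)"
  obtains "i = 0" | "i \<in> {1..3}"
  using assms by (cases "i = 0") auto

lemma sqdist_axis_spoke:
  assumes "j \<in> {1..3}"
  shows "(dist (base + \<alpha> *\<^sub>R axis + \<beta> *\<^sub>R spoke j) (base + \<tau> *\<^sub>R axis))\<^sup>2
      = ((\<alpha> - \<tau>)\<^sup>2 + \<beta>\<^sup>2 * q) / (1 + q)"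
proof -
  have "(dist (base + \<alpha> *\<^sub>R axis + \<beta> *\<^sub>R spoke j) (base + \<tau> *\<^sub>R axis))\<^sup>2
      = ((\<alpha> - \<tau>) *\<^sub>R axis + \<beta> *\<^sub>R spoke j) \<bullet> ((\<alpha> - \<tau>) *\<^sub>R axis + \<beta> *\<^sub>R spoke j)"
    by (simp add: dist_norm power2_norm_eq_inner[symmetric] algebra_simps)
  also have "\<dots> = (\<alpha> - \<tau>)\<^sup>2 * (axis \<bullet> axis) + \<beta>\<^sup>2 * (spoke j \<bullet> spoke j)"
    using axis_spoke[OF assms]
    by (simp add: inner_add_left inner_add_right inner_commute power2_eq_square)
  finally show ?thesis
    using assms by (simp add: axis_axis spoke_spoke add_divide_distrib)
qed

lemma sqdist_spoke_vertex:
  assumes "i \<in> {1..3}" "j \<in> {1..3}"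
  shows "(dist (base + \<alpha> *\<^sub>R axis + \<beta> *\<^sub>R spoke j) (v i))\<^sup>2
      = (\<alpha>\<^sup>2 + q * (if i = j then (1 - \<beta>)\<^sup>2 else \<beta>\<^sup>2 + \<beta> + 1)) / (1 + q)"
proof -
  have "(dist (base + \<alpha> *\<^sub>R axis + \<beta> *\<^sub>R spoke j) (v i))\<^sup>2
      = (\<alpha> *\<^sub>R axis + (\<beta> *\<^sub>R spoke j - spoke i)) \<bullet> (\<alpha> *\<^sub>R axis + (\<beta> *\<^sub>R spoke j - spoke i))"
    by (simp add: dist_norm power2_norm_eq_inner[symmetric] v_spoke algebra_simps)
  also have "\<dots> = \<alpha>\<^sup>2 * (axis \<bullet> axis) + \<beta>\<^sup>2 * (spoke j \<bullet> spoke j) + spoke i \<bullet> spoke i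
      - 2 * \<beta> * (spoke i \<bullet> spoke j)"
    using assms[THEN axis_spoke]
    by (simp add: inner_add_left inner_add_right inner_diff_left inner_diff_right inner_commute
        power2_eq_square algebra_simps)
  also have "\<dots> = (\<alpha>\<^sup>2 + q * (if i = j then (1 - \<beta>)\<^sup>2 else \<beta>\<^sup>2 + \<beta> + 1)) / (1 + q)"
    unfolding axis_axis spoke_spoke[OF assms(1,1)] spoke_spoke[OF assms(2,2)] spoke_spoke[OF assms]
    by (simp add: add_divide_distrib diff_divide_distrib power2_eq_square algebra_simps)
  finally show ?thesis .
qed

lemma sqdist_axis_apex: "(dist (base + \<tau> *\<^sub>R axis) (v 0))\<^sup>2 = (1 - \<tau>)\<^sup>2 / (1 + q)"
  using sqdist_axis_spoke[of 1 1 0 \<tau>] by (simp add: v_0 dist_commute)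

lemma sqdist_axis_vertex:
  "i \<in> {1..3} \<Longrightarrow> (dist (base + \<tau> *\<^sub>R axis) (v i))\<^sup>2 = (\<tau>\<^sup>2 + q) / (1 + q)"
  using sqdist_spoke_vertex[of i i \<tau> 0] by simp

lemma inj_vertex: "inj_on v {..3}"
proof (rule inj_onI)
  fix i j assume ij: "i \<in> {..3}" "j \<in> {..3}" "v i = v j"
  have apex: "v 0 \<noteq> v k" if "k \<in> {1..3}" for k
  proof -
    have "dist (v 0) (v k) = 1"
      using pyramid that unfolding triangular_pyramid_def by blast
    then show ?thesis by auto
  qed
  have rim: "v k \<noteq> v l" if kl: "k \<in> {1..3}" "l \<in> {1..3}" "k \<noteq> l" for k l
  proof
    assume "v k = v l"
    then have "3 * q / (1 + q) = 0"
      using edge_sqdist[OF kl] by (simp add: spoke_def)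
    then show False using q_pos by simp
  qed
  show "i = j"
  proof (rule ccontr)
    assume "i \<noteq> j"
    with ij(1,2) consider "i = 0" "j \<in> {1..3}" | "j = 0" "i \<in> {1..3}"
      | "i \<in> {1..3}" "j \<in> {1..3}"
      unfolding atMost_3 by blast
    then show False
    proof cases
      case 1
      with apex[of j] ij(3) show ?thesis by simp
    next
      case 2
      with apex[of i] ij(3) show ?thesis by simp
    next
      case 3
      with rim[of i j] \<open>i \<noteq> j\<close> ij(3) show ?thesis by simp
    qed
  qed
qed

lemma sum_vertices:
  "(\<Sum>i\<in>{..3}. u i *\<^sub>R v i)
    = sum u {..3} *\<^sub>R base + u 0 *\<^sub>R axis + (\<Sum>i\<in>{1..3}. u i *\<^sub>R spoke i)"
proof -
  have "(\<Sum>i\<in>{..3}. u i *\<^sub>R v i) = (\<Sum>i\<in>{..3}. u i *\<^sub>R base + u i *\<^sub>R (v i - base))"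
    by (simp add: scaleR_diff_right)
  also have "\<dots> = sum u {..3} *\<^sub>R base + (\<Sum>i\<in>{..3}. u i *\<^sub>R (v i - base))"
    by (simp only: sum.distrib scaleR_sum_left)
  also have "(\<Sum>i\<in>{..3}. u i *\<^sub>R (v i - base)) = u 0 *\<^sub>R axis + (\<Sum>i\<in>{1..3}. u i *\<^sub>R spoke i)"
    unfolding atMost_3 axis_def spoke_def by simp
  finally show ?thesis by (simp only: add.assoc)
qed

text \<open>
  Inner products with the axis and with the spokes isolate the coefficients of an affine
  dependence.
\<close>

lemma vertices_affine_independent: "\<not> affine_dependent (vertices v)"
proof
  assume "affine_dependent (vertices v)"
  then obtain U where U: "sum U (v ` {..3}) = 0" "\<exists>x\<in>v ` {..3}. U x \<noteq> 0"
      "(\<Sum>x\<in>v ` {..3}. U x *\<^sub>R x) = 0"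
    unfolding vertices_def by (auto simp: affine_dependent_explicit_finite)
  define u where "u i = U (v i)" for i
  have u_sum: "sum u {..3} = 0" and "(\<Sum>i\<in>{..3}. u i *\<^sub>R v i) = 0"
    using U by (simp_all add: sum.reindex[OF inj_vertex] u_def)
  then have 0: "u 0 *\<^sub>R axis + (\<Sum>i\<in>{1..3}. u i *\<^sub>R spoke i) = 0"
    using sum_vertices[of u] by simp
  have "0 = axis \<bullet> (u 0 *\<^sub>R axis + (\<Sum>i\<in>{1..3}. u i *\<^sub>R spoke i))" by (simp only: 0) simp
  also have "\<dots> = u 0 / (1 + q)"
    by (simp add: inner_add_right inner_sum_right axis_spoke axis_axis)
  finally have u0: "u 0 = 0" using q_pos by simp
  have "u j = 0" if j: "j \<in> {1..3}" for j
  proof -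
    define s where "s = q / (1 + q)"
    have "0 = spoke j \<bullet> (u 0 *\<^sub>R axis + (\<Sum>i\<in>{1..3}. u i *\<^sub>R spoke i))" by (simp only: 0) simp
    also have "\<dots> = (\<Sum>i\<in>{1..3}. u i * ((if i = j then 1 else - 1/2) * s))"
      using j by (simp add: inner_add_right inner_sum_right spoke_spoke u0 eq_commute[of j] s_def)
    also have "\<dots> = (\<Sum>i\<in>{1..3}. (if i = j then 3/2 * u j * s else 0) - u i * (s / 2))"
      by (intro sum.cong) auto
    also have "\<dots> = 3/2 * u j * s - sum u {1..3} * (s / 2)"
      using j by (simp add: sum_subtractf sum_distrib_right)
    also have "sum u {1..3} = 0" using u_sum u0 by (simp add: atMost_3)
    finally show ?thesis using q_pos by (simp add: s_def)
  qed
  with u0 have "\<forall>i\<in>{..3}. u i = 0" unfolding atMost_3 by blast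
  with U(2) show False by (auto simp: u_def)
qed

lemma card_vertices: "card (vertices v) = 4"
  unfolding vertices_def by (simp add: card_image[OF inj_vertex])

lemma affine_hull_vertices: "affine hull (v ` {..3}) = UNIV"
  using affine_independent_span_eq[OF vertices_affine_independent] card_vertices
  by (simp add: vertices_def)

text \<open>
  The axis point realises these distances, and a point is determined by its squared distances to
  the affinely spanning vertices.
\<close>

lemma has_sqdists_iff:
  "has_sqdists v P ((1 - \<tau>)\<^sup>2 / (1 + q)) ((\<tau>\<^sup>2 + q) / (1 + q)) ((\<tau>\<^sup>2 + q) / (1 + q)) ((\<tau>\<^sup>2 + q) / (1 + q))
    \<longleftrightarrow> P = base + \<tau> *\<^sub>R axis"
proof
  assume P: "has_sqdists v P ((1 - \<tau>)\<^sup>2 / (1 + q)) ((\<tau>\<^sup>2 + q) / (1 + q)) ((\<tau>\<^sup>2 + q) / (1 + q)) ((\<tau>\<^sup>2 + q) / (1 + q))"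
  have "(dist P (v i))\<^sup>2 - (dist (base + \<tau> *\<^sub>R axis) (v i))\<^sup>2 = 0" if i: "i \<le> 3" for i
  proof -
    from i consider "i = 0" | "i = 1" | "i = 2" | "i = 3" by linarith
    then show ?thesis
      using P sqdist_axis_apex[of \<tau>] sqdist_axis_vertex[of i \<tau>]
      by cases (auto simp: has_sqdists_def)
  qed
  then show "P = base + \<tau> *\<^sub>R axis"
    by (intro eq_if_sqdist_difference_constant[OF affine_hull_vertices, where d = 0]) auto
next
  assume "P = base + \<tau> *\<^sub>R axis"
  then show "has_sqdists v P ((1 - \<tau>)\<^sup>2 / (1 + q)) ((\<tau>\<^sup>2 + q) / (1 + q)) ((\<tau>\<^sup>2 + q) / (1 + q)) ((\<tau>\<^sup>2 + q) / (1 + q))"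
    using sqdist_axis_apex[of \<tau>] sqdist_axis_vertex[of _ \<tau>] by (simp add: has_sqdists_def)
qed

text \<open>
  Barycentric coordinates of the axis point at height \<open>\<tau>\<close>.
\<close>

definition weight :: "real \<Rightarrow> nat \<Rightarrow> real" where
  "weight \<tau> i = (if i = 0 then \<tau> else (1 - \<tau>) / 3)"

lemma sum_weight: "sum (weight \<tau>) {..3} = 1"
  by (simp add: atMost_3 weight_def diff_divide_distrib)

lemma weight_bary: "(\<Sum>i\<in>{..3}. weight \<tau> i *\<^sub>R v i) = base + \<tau> *\<^sub>R axis"
proof -
  have "(\<Sum>i\<in>{1..3}. weight \<tau> i *\<^sub>R spoke i) = ((1 - \<tau>) / 3) *\<^sub>R (\<Sum>i\<in>{1..3}. spoke i)"
    unfolding scaleR_sum_right by (intro sum.cong) (auto simp: weight_def)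
  then show ?thesis
    unfolding sum_vertices sum_weight sum_spoke by (simp add: weight_def)
qed

lemma axis_point_in_interior_iff:
  "base + \<tau> *\<^sub>R axis \<in> interior (convex hull vertices v) \<longleftrightarrow> 0 < \<tau> \<and> \<tau> < 1"
proof -
  have "base + \<tau> *\<^sub>R axis \<in> interior (convex hull vertices v) \<longleftrightarrow>
      (\<exists>U. (\<forall>i\<in>{..3}. 0 < U (v i)) \<and> (\<Sum>i\<in>{..3}. U (v i)) = 1
        \<and> (\<Sum>i\<in>{..3}. U (v i) *\<^sub>R v i) = base + \<tau> *\<^sub>R axis)"
    using interior_convex_hull_explicit_minimal[OF vertices_affine_independent] card_vertices
    by (simp add: vertices_def sum.reindex[OF inj_vertex])
  also have "\<dots> \<longleftrightarrow> 0 < \<tau> \<and> \<tau> < 1"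
  proof
    assume "\<exists>U. (\<forall>i\<in>{..3}. 0 < U (v i)) \<and> (\<Sum>i\<in>{..3}. U (v i)) = 1
        \<and> (\<Sum>i\<in>{..3}. U (v i) *\<^sub>R v i) = base + \<tau> *\<^sub>R axis"
    then obtain U where U: "\<forall>i\<in>{..3}. 0 < U (v i)" "(\<Sum>i\<in>{..3}. U (v i)) = 1"
        "(\<Sum>i\<in>{..3}. U (v i) *\<^sub>R v i) = base + \<tau> *\<^sub>R axis" by blast
    define u where "u i = U (v i)" for i
    have u: "\<And>i. i \<in> {..3} \<Longrightarrow> 0 < u i" "sum u {..3} = 1"
        "(\<Sum>i\<in>{..3}. u i *\<^sub>R v i) = base + \<tau> *\<^sub>R axis"
      using U by (simp_all add: u_def)
    have "axis \<bullet> (u 0 *\<^sub>R axis + (\<Sum>i\<in>{1..3}. u i *\<^sub>R spoke i)) = axis \<bullet> (\<tau> *\<^sub>R axis)"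
      using u(2,3) unfolding sum_vertices by (simp add: add.assoc)
    then have "u 0 = \<tau>"
      using q_pos by (simp add: inner_add_right inner_sum_right axis_spoke axis_axis)
    moreover have "sum u {1..3} > 0" using u(1) by (intro sum_pos) auto
    ultimately show "0 < \<tau> \<and> \<tau> < 1"
      using u(1)[of 0] u(2) by (simp add: atMost_3)
  next
    assume \<tau>: "0 < \<tau> \<and> \<tau> < 1"
    define U where "U x = weight \<tau> (the_inv_into {..3} v x)" for x
    have U: "U (v i) = weight \<tau> i" if "i \<in> {..3}" for i
      using the_inv_into_f_f[OF inj_vertex that] by (simp add: U_def)
    have "(\<Sum>i\<in>{..3}. U (v i)) = 1" "(\<Sum>i\<in>{..3}. U (v i) *\<^sub>R v i) = base + \<tau> *\<^sub>R axis"
      unfolding sum_weight[of \<tau>, symmetric] weight_bary[symmetric]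
      using U by (auto intro: sum.cong)
    moreover have "\<forall>i\<in>{..3}. 0 < U (v i)" using \<tau> U by (auto simp: weight_def)
    ultimately show "\<exists>U. (\<forall>i\<in>{..3}. 0 < U (v i)) \<and> (\<Sum>i\<in>{..3}. U (v i)) = 1
        \<and> (\<Sum>i\<in>{..3}. U (v i) *\<^sub>R v i) = base + \<tau> *\<^sub>R axis"
      by blast
  qed
  finally show ?thesis .
qed

text \<open>
  The circumsphere meets the axis at the heights \<open>1\<close> and \<open>- q\<close>, so its centre is at their mean.
\<close>

lemma circumcentre:
  assumes "i \<le> 3"
  shows "dist (base + ((1 - q) / 2) *\<^sub>R axis) (v i) = sqrt ((1 + q) / 4)"
proof -
  have "(dist (base + ((1 - q) / 2) *\<^sub>R axis) (v i))\<^sup>2 = (1 + q) / 4"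
    using assms
  proof (cases rule: index_cases)
    case 1
    have "(1 - (1 - q) / 2)\<^sup>2 / (1 + q) = (1 + q) / 4"
      using q_pos by (simp add: field_simps power2_eq_square)
    then show ?thesis by (simp only: 1 sqdist_axis_apex)
  next
    case 2
    have "(((1 - q) / 2)\<^sup>2 + q) / (1 + q) = (1 + q) / 4"
      using q_pos by (simp add: field_simps power2_eq_square)
    then show ?thesis by (simp only: 2 sqdist_axis_vertex)
  qed
  then show ?thesis by (metis real_sqrt_unique zero_le_dist)
qed

lemma circumradius_vertices: "circumradius (vertices v) = sqrt ((1 + q) / 4)"
  unfolding circumradius_def
proof (rule the_equality)
  show "\<exists>c. vertices v \<subseteq> sphere c (sqrt ((1 + q) / 4))"
    using circumcentre by (intro exI[of _ "base + ((1 - q) / 2) *\<^sub>R axis"])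
      (auto simp: vertices_def)
next
  fix R assume "\<exists>c. vertices v \<subseteq> sphere c R"
  then obtain c where "vertices v \<subseteq> sphere c R" ..
  then have c: "\<And>i. i \<le> 3 \<Longrightarrow> dist c (v i) = R"
    by (auto simp: vertices_def)
  have "c = base + ((1 - q) / 2) *\<^sub>R axis"
    using c circumcentre
    by (intro eq_if_sqdist_difference_constant[OF affine_hull_vertices,
          where d = "R\<^sup>2 - (sqrt ((1 + q) / 4))\<^sup>2"]) auto
  with c[of 0] circumcentre[of 0] show "R = sqrt ((1 + q) / 4)" by simp
qed

text \<open>
  The centre of the sphere through the axis point \<open>O\<close> at height \<open>\<tau>\<close> and all vertices except \<open>v j\<close>. For
  \<open>j = 0\<close> it lies on the axis. For the other \<open>j\<close> it is equidistant from \<open>O\<close> and the apex, hence at their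
  mean height, and lies in the plane of symmetry through the axis and \<open>v j\<close>.
\<close>

definition centre :: "real \<Rightarrow> nat \<Rightarrow> real^3" where
  "centre \<tau> j = (if j = 0 then base + ((\<tau>\<^sup>2 - q) / (2 * \<tau>)) *\<^sub>R axis
     else base + ((1 + \<tau>) / 2) *\<^sub>R axis + (- (q + \<tau>) / q) *\<^sub>R spoke j)"

text \<open>
  The two equations express the squared radius as the squared distance from \<open>O\<close> to the centre on the
  axis and to the other centres, respectively. The distances to the vertices then agree with the one
  to \<open>O\<close> because of the position of the centres.
\<close>

lemma
  assumes \<tau>: "\<tau> \<noteq> 0" and k1: "k * \<tau>\<^sup>2 = (\<tau>\<^sup>2 + q)\<^sup>2"
    and k2: "q * k = 4 * (q + \<tau>)\<^sup>2 + q * (1 - \<tau>)\<^sup>2"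
  shows dist_centre: "j \<le> 3 \<Longrightarrow> dist (centre \<tau> j) (base + \<tau> *\<^sub>R axis) = sqrt (k / (4 * (1 + q)))"
    and dist_centre_vertex:
      "i \<le> 3 \<Longrightarrow> j \<le> 3 \<Longrightarrow> i \<noteq> j \<Longrightarrow> dist (centre \<tau> j) (v i) = sqrt (k / (4 * (1 + q)))"
proof -
  have k: "k / (4 * (1 + q)) = (k / 4) / (1 + q)" by simp
  have k1': "k / 4 = ((\<tau>\<^sup>2 + q) / (2 * \<tau>))\<^sup>2"
    using \<tau> k1 by (simp add: power_divide power_mult_distrib field_simps)
  define \<beta> where "\<beta> = - (q + \<tau>) / q"
  have \<beta>: "\<beta> * q = - (q + \<tau>)" using q_pos by (simp add: \<beta>_def)
  have k2': "k / 4 = ((1 - \<tau>) / 2)\<^sup>2 + \<beta>\<^sup>2 * q"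
  proof -
    have "(\<beta> * q)\<^sup>2 = (q + \<tau>)\<^sup>2" unfolding \<beta> by (simp add: power2_eq_square algebra_simps)
    moreover have "q * (((1 - \<tau>) / 2)\<^sup>2 + \<beta>\<^sup>2 * q) = q * (1 - \<tau>)\<^sup>2 / 4 + (\<beta> * q)\<^sup>2"
      by (simp add: power_divide power_mult_distrib distrib_left power2_eq_square[of q])
    ultimately have "q * (k / 4) = q * (((1 - \<tau>) / 2)\<^sup>2 + \<beta>\<^sup>2 * q)"
      using k2 by simp
    then show ?thesis using q_pos by simp
  qed
  have centre_0: "centre \<tau> 0 = base + ((\<tau>\<^sup>2 - q) / (2 * \<tau>)) *\<^sub>R axis"
    by (simp add: centre_def)
  have centre_j: "centre \<tau> j = base + ((1 + \<tau>) / 2) *\<^sub>R axis + \<beta> *\<^sub>R spoke j" if "j \<in> {1..3}" for j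
    using that by (simp add: centre_def \<beta>_def)
  show "dist (centre \<tau> j) (base + \<tau> *\<^sub>R axis) = sqrt (k / (4 * (1 + q)))" if "j \<le> 3"
  proof -
    have "(dist (centre \<tau> j) (base + \<tau> *\<^sub>R axis))\<^sup>2 = k / (4 * (1 + q))"
      using that
    proof (cases rule: index_cases)
      case 1
      have "((\<tau>\<^sup>2 - q) / (2 * \<tau>) - \<tau>)\<^sup>2 = k / 4"
        unfolding k1' using \<tau> by (simp add: field_simps power2_eq_square)
      with sqdist_axis_spoke[of 1 "(\<tau>\<^sup>2 - q) / (2 * \<tau>)" 0 \<tau>] show ?thesis
        unfolding 1 centre_0 k by simp
    next
      case 2
      have "((1 + \<tau>) / 2 - \<tau>)\<^sup>2 + \<beta>\<^sup>2 * q = k / 4"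
        unfolding k2' by (simp add: power2_eq_square field_simps)
      then show ?thesis
        unfolding centre_j[OF 2] k sqdist_axis_spoke[OF 2] by (simp only:)
    qed
    then show ?thesis by (metis real_sqrt_unique zero_le_dist)
  qed
  show "dist (centre \<tau> j) (v i) = sqrt (k / (4 * (1 + q)))" if "i \<le> 3" "j \<le> 3" "i \<noteq> j"
  proof -
    have "(dist (centre \<tau> j) (v i))\<^sup>2 = k / (4 * (1 + q))"
      using that(2)
    proof (cases rule: index_cases)
      case 1
      with that have i: "i \<in> {1..3}" by auto
      have "((\<tau>\<^sup>2 - q) / (2 * \<tau>))\<^sup>2 + q = k / 4"
        unfolding k1' using \<tau> by (simp add: field_simps power2_eq_square)
      with sqdist_axis_vertex[OF i, of "(\<tau>\<^sup>2 - q) / (2 * \<tau>)"] show ?thesis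
        unfolding 1 centre_0 k by simp
    next
      case j: 2
      from that(1) show ?thesis
      proof (cases rule: index_cases)
        case 1
        have "((1 + \<tau>) / 2 - 1)\<^sup>2 + \<beta>\<^sup>2 * q = k / 4"
          unfolding k2' by (simp add: power2_eq_square field_simps)
        moreover have "v 0 = base + 1 *\<^sub>R axis" by (simp add: v_0)
        ultimately show ?thesis
          unfolding centre_j[OF j] k 1 by (simp only: sqdist_axis_spoke[OF j])
      next
        case i: 2
        have "((1 + \<tau>) / 2)\<^sup>2 + q * (\<beta>\<^sup>2 + \<beta> + 1) = ((1 + \<tau>) / 2)\<^sup>2 + \<beta>\<^sup>2 * q + \<beta> * q + q"
          by (simp add: algebra_simps)
        also have "\<dots> = k / 4"
          unfolding k2' \<beta> by (simp add: power2_eq_square field_simps)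
        finally show ?thesis
          unfolding centre_j[OF j] k sqdist_spoke_vertex[OF i j] using that(3)
          by (simp only: if_False)
      qed
    qed
    then show ?thesis by (metis real_sqrt_unique zero_le_dist)
  qed
qed

lemma hulloid_pyramid:
  assumes \<tau>: "0 < \<tau>" "\<tau> < 1" and sol: "axial_solution q k \<tau>" and k: "(1 + q)\<^sup>2 < k"
  shows "r_hulloid (sqrt (k / (4 * (1 + q)))) (vertices v) = vertices v \<union> {base + \<tau> *\<^sub>R axis}"
    and "circumradius (vertices v) < sqrt (k / (4 * (1 + q)))"
proof -
  have k1: "k * \<tau>\<^sup>2 = (\<tau>\<^sup>2 + q)\<^sup>2" and k2: "q * k = 4 * (q + \<tau>)\<^sup>2 + q * (1 - \<tau>)\<^sup>2"
    using sol \<tau> by (auto simp: axial_solution_def)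
  have "\<tau> \<noteq> 0" using \<tau> by simp
  note centres = dist_centre[OF this k1 k2] dist_centre_vertex[OF this k1 k2]
  interpret body_simplex "{..3::nat}" v "base + \<tau> *\<^sub>R axis" "weight \<tau>" "centre \<tau>"
    "sqrt (k / (4 * (1 + q)))"
    using \<tau> centres inj_vertex affine_hull_vertices sum_weight weight_bary
    by unfold_locales (auto simp: weight_def)
  have "(1 + q) / 4 < k / (4 * (1 + q))"
    using k q_pos by (simp add: field_simps power2_eq_square)
  then have less: "sqrt ((1 + q) / 4) < sqrt (k / (4 * (1 + q)))" by simp
  then show "circumradius (vertices v) < sqrt (k / (4 * (1 + q)))"
    by (simp only: circumradius_vertices)
  show "r_hulloid (sqrt (k / (4 * (1 + q)))) (vertices v) = vertices v \<union> {base + \<tau> *\<^sub>R axis}"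
    unfolding vertices_def
  proof (rule hulloid_eq[OF _ less])
    show "dist (base + ((1 - q) / 2) *\<^sub>R axis) (v i) = sqrt ((1 + q) / 4)" if "i \<in> {..3}" for i
      using that by (intro circumcentre) simp
  qed
qed

lemma geometrically_admissible_axis_point:
  assumes "\<tau> \<noteq> 1" "axial_solution q k \<tau>"
  shows "geometrically_admissible v (sqrt (k / (4 * (1 + q)))) (base + \<tau> *\<^sub>R axis)"
proof -
  have k1: "k * \<tau>\<^sup>2 = (\<tau>\<^sup>2 + q)\<^sup>2" and k2: "q * k = 4 * (q + \<tau>)\<^sup>2 + q * (1 - \<tau>)\<^sup>2"
    using assms by (auto simp: axial_solution_def)
  have pos: "0 < \<tau>\<^sup>2 + q" using q_pos by (simp add: add_nonneg_pos)
  then have \<tau>: "\<tau> \<noteq> 0" using k1 by auto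
  have "0 < k * \<tau>\<^sup>2" unfolding k1 using pos by simp
  then have "0 < k" by (simp add: zero_less_mult_iff)
  then have "0 < sqrt (k / (4 * (1 + q)))" using q_pos by simp
  moreover have "0 < (1 - \<tau>)\<^sup>2 / (1 + q)" "0 < (\<tau>\<^sup>2 + q) / (1 + q)"
    using assms(1) pos q_pos by simp_all
  ultimately show ?thesis
    unfolding geometrically_admissible_def
    using has_sqdists_iff[of "base + \<tau> *\<^sub>R axis" \<tau>]
      dist_centre[OF \<tau> k1 k2] dist_centre_vertex[OF \<tau> k1 k2]
    by (metis mem_sphere)
qed

end

section \<open>Solutions of the system and body configurations\<close>

theorem theorem6:
  fixes \<eta> :: real and v :: "nat \<Rightarrow> real^3"
  assumes "triangular_pyramid \<eta> v"
  shows
    "(\<eta> < 12/5 \<longrightarrow>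
        (\<exists>!\<rho>. poly (g_poly \<eta>) \<rho> = 0) \<and>
        (\<forall>\<rho>. poly (g_poly \<eta>) \<rho> = 0 \<longrightarrow>
           (\<exists>!XY. pyramid_system \<eta> \<rho> (fst XY) (snd XY)) \<and>
           (\<forall>X Y. pyramid_system \<eta> \<rho> X Y \<longrightarrow>
              (\<exists>!P. has_sqdists v P X Y Y Y) \<and>
              (\<forall>P. has_sqdists v P X Y Y Y \<longrightarrow>
                 sqrt \<rho> > circumradius (vertices v) \<and>
                 r_hulloid (sqrt \<rho>) (vertices v) = vertices v \<union> {P} \<and>
                 P \<in> interior (convex hull vertices v)))))
     \<and>
     (12/5 \<le> \<eta> \<longrightarrow>
        (\<exists>\<rho> X Y. poly (g_poly \<eta>) \<rho> = 0 \<and> pyramid_system \<eta> \<rho> X Y \<and> X \<noteq> 0) \<and>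
        (\<forall>\<rho> X Y. poly (g_poly \<eta>) \<rho> = 0 \<and> pyramid_system \<eta> \<rho> X Y \<longrightarrow>
           (\<exists>!P. has_sqdists v P X Y Y Y) \<and>
           (\<forall>P. has_sqdists v P X Y Y Y \<longrightarrow>
              (\<not> (\<eta> = 12/5 \<and> X = 0) \<longrightarrow> geometrically_admissible v (sqrt \<rho>) P) \<and>
              \<not> (\<exists>c. body_configuration v (sqrt \<rho>) P c))))"
proof -
  have \<eta>: "0 < \<eta>" "\<eta> < 3" using assms by (auto simp: triangular_pyramid_def)
  define q where "q = \<eta> / (3 - \<eta>)"
  have q: "0 < q" using \<eta> by (simp add: q_def)
  have \<eta>_q: "\<eta> = 3 * q / (1 + q)" using \<eta> by (simp add: q_def field_simps)
  have q_less: "\<eta> < 12/5 \<longleftrightarrow> q < 4" and q_eq: "\<eta> = 12/5 \<longleftrightarrow> q = 4"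
    using \<eta> by (auto simp: q_def pos_divide_less_eq divide_eq_eq)
  interpret pyramid q v
    using q assms by unfold_locales (simp_all add: \<eta>_q)
  have nz: "1 + q \<noteq> 0" using q by simp
  have all_\<rho>: "(\<forall>\<rho>. Q \<rho>) \<longleftrightarrow> (\<forall>k. Q (k / (4 * (1 + q))))" for Q :: "real \<Rightarrow> bool"
  proof (intro iffI allI)
    fix \<rho> assume "\<forall>k. Q (k / (4 * (1 + q)))"
    then have "Q (\<rho> * (4 * (1 + q)) / (4 * (1 + q)))" by blast
    then show "Q \<rho>" using nz by simp
  qed simp
  have g: "poly (g_poly \<eta>) (k / (4 * (1 + q))) = 0 \<longleftrightarrow> eliminant q k = 0" for k
    unfolding \<eta>_q poly_g_poly_scaled[OF q] using nz by simp
  have sys: "pyramid_system \<eta> (k / (4 * (1 + q))) X Y \<longleftrightarrow>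
    (\<exists>\<tau>. X = (1 - \<tau>)\<^sup>2 / (1 + q) \<and> Y = (\<tau>\<^sup>2 + q) / (1 + q) \<and> axial_solution q k \<tau>)" for k X Y
    unfolding \<eta>_q by (rule pyramid_system_scaled_iff[OF q])
  obtain \<tau>0 where \<tau>0: "0 < \<tau>0" "\<tau>0 < q" "axial_cubic q \<tau>0 = 0"
    using axial_cubic_positive_root[OF q] .
  define k0 where "k0 = (\<tau>0\<^sup>2 + q)\<^sup>2 / \<tau>0\<^sup>2"
  have sol0: "axial_solution q k0 \<tau>0"
    unfolding k0_def using axial_cubic_zero_imp_solution[OF q \<tau>0(3)] .
  have elim0: "eliminant q k0 = 0"
    unfolding k0_def using \<tau>0 by (intro eliminant_at_cubic_root) auto
  have cubic_root: "axial_cubic q \<tau> = 0 \<Longrightarrow> 0 < \<tau> \<Longrightarrow> \<tau> = \<tau>0" for \<tau>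
    using axial_cubic_strict_mono[OF q, of \<tau> \<tau>0] axial_cubic_strict_mono[OF q, of \<tau>0 \<tau>] \<tau>0
    by (cases \<tau> \<tau>0 rule: linorder_cases) auto
  show ?thesis
  proof (intro conjI impI)
    assume "\<eta> < 12/5"
    then have q4: "q < 4" using q_less by blast
    have unique_k: "eliminant q k = 0 \<longleftrightarrow> k = k0" for k
      using eliminant_root_unique[OF q q4 _ elim0] elim0 by blast
    have unique_\<tau>: "axial_solution q k0 \<tau> \<longleftrightarrow> \<tau> = \<tau>0" for \<tau>
    proof
      assume "axial_solution q k0 \<tau>"
      from axial_solution_cases[OF q this] show "\<tau> = \<tau>0"
      proof cases
        case 3
        then show ?thesis using axial_cubic_root_pos[OF q q4] cubic_root by blast
      qed (use elim0 eliminant_circumsphere_eq_0_iff[OF q] q4 in auto)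
    qed (use sol0 in simp)
    have \<tau>0_less: "\<tau>0 < 1"
    proof (rule ccontr)
      assume "\<not> ?thesis"
      then have "axial_cubic q 1 \<le> axial_cubic q \<tau>0"
        using axial_cubic_strict_mono[OF q, of 1 \<tau>0] by (cases "\<tau>0 = 1") auto
      moreover have "0 < axial_cubic q 1" using q q4 by (simp add: axial_cubic_at_1)
      ultimately show False using \<tau>0(3) by simp
    qed
    \<comment> \<open>The axis point is below the apex and below the height \<open>q\<close>, and
        \<open>\<tau>\<^sup>2 + q - (1 + q) * \<tau> = (1 - \<tau>) * (q - \<tau>)\<close>. This makes the radius exceed the circumradius.\<close>
    have k0: "(1 + q)\<^sup>2 < k0"
    proof -
      have "0 < (1 - \<tau>0) * (q - \<tau>0)" using \<tau>0_less \<tau>0 by simp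
      then have "(1 + q) * \<tau>0 < \<tau>0\<^sup>2 + q" by (simp add: power2_eq_square algebra_simps)
      then have "((1 + q) * \<tau>0)\<^sup>2 < (\<tau>0\<^sup>2 + q)\<^sup>2"
        using q \<tau>0 by (intro power_strict_mono) auto
      then show ?thesis
        using \<tau>0 by (simp add: k0_def power_mult_distrib less_divide_eq)
    qed
    show "\<exists>!\<rho>. poly (g_poly \<eta>) \<rho> = 0"
    proof (rule ex1I)
      show "poly (g_poly \<eta>) (k0 / (4 * (1 + q))) = 0" using g elim0 by blast
      show "\<rho> = k0 / (4 * (1 + q))" if "poly (g_poly \<eta>) \<rho> = 0" for \<rho>
        using that all_\<rho>[of "\<lambda>\<rho>. poly (g_poly \<eta>) \<rho> = 0 \<longrightarrow> \<rho> = k0 / (4 * (1 + q))"]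
        unfolding g unique_k by blast
    qed
    show "\<forall>\<rho>. poly (g_poly \<eta>) \<rho> = 0 \<longrightarrow>
           (\<exists>!XY. pyramid_system \<eta> \<rho> (fst XY) (snd XY)) \<and>
           (\<forall>X Y. pyramid_system \<eta> \<rho> X Y \<longrightarrow>
              (\<exists>!P. has_sqdists v P X Y Y Y) \<and>
              (\<forall>P. has_sqdists v P X Y Y Y \<longrightarrow>
                 sqrt \<rho> > circumradius (vertices v) \<and>
                 r_hulloid (sqrt \<rho>) (vertices v) = vertices v \<union> {P} \<and>
                 P \<in> interior (convex hull vertices v)))"
    proof (rule all_\<rho>[THEN iffD2], unfold g unique_k, intro allI impI, unfold sys, clarify,
        unfold unique_\<tau>, intro conjI)
      show "\<exists>!XY. \<exists>\<tau>. fst XY = (1 - \<tau>)\<^sup>2 / (1 + q) \<and> snd XY = (\<tau>\<^sup>2 + q) / (1 + q) \<and> \<tau> = \<tau>0"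
        by (rule ex1I[of _ "((1 - \<tau>0)\<^sup>2 / (1 + q), (\<tau>0\<^sup>2 + q) / (1 + q))"]) (auto simp: prod_eq_iff)
    next
      show "\<forall>X Y. (\<exists>\<tau>. X = (1 - \<tau>)\<^sup>2 / (1 + q) \<and> Y = (\<tau>\<^sup>2 + q) / (1 + q) \<and> \<tau> = \<tau>0) \<longrightarrow>
              (\<exists>!P. has_sqdists v P X Y Y Y) \<and>
              (\<forall>P. has_sqdists v P X Y Y Y \<longrightarrow>
                 sqrt (k0 / (4 * (1 + q))) > circumradius (vertices v) \<and>
                 r_hulloid (sqrt (k0 / (4 * (1 + q)))) (vertices v) = vertices v \<union> {P} \<and>
                 P \<in> interior (convex hull vertices v))"
        using hulloid_pyramid[OF \<tau>0(1) \<tau>0_less sol0 k0] \<tau>0(1) \<tau>0_less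
        by (auto simp: has_sqdists_iff axis_point_in_interior_iff)
    qed
  next
    assume "12/5 \<le> \<eta>"
    then have q4: "4 \<le> q" using q_less by linarith
    have \<tau>0_ge: "1 \<le> \<tau>0"
    proof (rule ccontr)
      assume "\<not> ?thesis"
      then have "axial_cubic q \<tau>0 < axial_cubic q 1"
        using \<tau>0 by (intro axial_cubic_strict_mono[OF q]) auto
      moreover have "axial_cubic q 1 \<le> 0"
        using q q4 by (simp add: axial_cubic_at_1 mult_nonpos_nonneg)
      ultimately show False using \<tau>0(3) by simp
    qed
    \<comment> \<open>At the threshold the positive root is the apex itself. There the antipode of the apex on the
        circumsphere is a solution with \<open>X \<noteq> 0\<close>.\<close>
    have "\<exists>k \<tau>. eliminant q k = 0 \<and> axial_solution q k \<tau> \<and> \<tau> \<noteq> 1"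
    proof (cases "q = 4")
      case True
      have "axial_solution q ((1 + q)\<^sup>2) (- q)"
        using q by (simp add: axial_solution_def power2_eq_square algebra_simps)
      then show ?thesis
        using True eliminant_circumsphere_eq_0_iff[OF q] q by (intro exI conjI) auto
    next
      case False
      then have "axial_cubic q 1 \<noteq> 0" using q by (simp add: axial_cubic_at_1)
      then have "\<tau>0 \<noteq> 1" using \<tau>0(3) by auto
      then show ?thesis using elim0 sol0 by blast
    qed
    then obtain k \<tau> where "eliminant q k = 0" "axial_solution q k \<tau>" "\<tau> \<noteq> 1" by blast
    then have "poly (g_poly \<eta>) (k / (4 * (1 + q))) = 0" "(1 - \<tau>)\<^sup>2 / (1 + q) \<noteq> 0"
      "pyramid_system \<eta> (k / (4 * (1 + q))) ((1 - \<tau>)\<^sup>2 / (1 + q)) ((\<tau>\<^sup>2 + q) / (1 + q))"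
      using nz unfolding g sys by auto
    then show "\<exists>\<rho> X Y. poly (g_poly \<eta>) \<rho> = 0 \<and> pyramid_system \<eta> \<rho> X Y \<and> X \<noteq> 0"
      by blast
    have nonbody: "(\<exists>!P. has_sqdists v P X Y Y Y) \<and>
           (\<forall>P. has_sqdists v P X Y Y Y \<longrightarrow>
              (\<not> (\<eta> = 12/5 \<and> X = 0) \<longrightarrow> geometrically_admissible v (sqrt (k / (4 * (1 + q)))) P) \<and>
              \<not> (\<exists>c. body_configuration v (sqrt (k / (4 * (1 + q)))) P c))"
      if k: "eliminant q k = 0" and sol: "axial_solution q k \<tau>"
        and X: "X = (1 - \<tau>)\<^sup>2 / (1 + q)" and Y: "Y = (\<tau>\<^sup>2 + q) / (1 + q)" for k \<tau> X Y
    proof -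
      have "\<not> (0 < \<tau> \<and> \<tau> < 1)"
        using axial_solution_cases[OF q sol]
      proof cases
        case 3
        then show ?thesis using cubic_root \<tau>0_ge by fastforce
      qed (use q in auto)
      then have "\<not> body_configuration v R (base + \<tau> *\<^sub>R axis) c" for R c
        by (simp add: body_configuration_def axis_point_in_interior_iff)
      moreover have "geometrically_admissible v (sqrt (k / (4 * (1 + q)))) (base + \<tau> *\<^sub>R axis)"
        if "\<not> (\<eta> = 12/5 \<and> X = 0)"
      proof -
        have "\<tau> \<noteq> 1"
        proof
          assume "\<tau> = 1"
          with sol have "k = (1 + q)\<^sup>2" by (simp add: axial_solution_def)
          with k have "q = 4" by (simp add: eliminant_circumsphere_eq_0_iff[OF q])
          then have "\<eta> = 12/5" using q_eq by blast
          moreover have "X = 0" using X \<open>\<tau> = 1\<close> by simp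
          ultimately show False using that by blast
        qed
        then show ?thesis using geometrically_admissible_axis_point sol by blast
      qed
      ultimately show ?thesis
        unfolding X Y by (auto simp: has_sqdists_iff)
    qed
    show "\<forall>\<rho> X Y. poly (g_poly \<eta>) \<rho> = 0 \<and> pyramid_system \<eta> \<rho> X Y \<longrightarrow>
           (\<exists>!P. has_sqdists v P X Y Y Y) \<and>
           (\<forall>P. has_sqdists v P X Y Y Y \<longrightarrow>
              (\<not> (\<eta> = 12/5 \<and> X = 0) \<longrightarrow> geometrically_admissible v (sqrt \<rho>) P) \<and>
              \<not> (\<exists>c. body_configuration v (sqrt \<rho>) P c))"
    proof (rule all_\<rho>[THEN iffD2], unfold g, intro allI impI)
      fix k X Y
      assume "eliminant q k = 0 \<and> pyramid_system \<eta> (k / (4 * (1 + q))) X Y"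
      then obtain \<tau> where "eliminant q k = 0" "X = (1 - \<tau>)\<^sup>2 / (1 + q)" "Y = (\<tau>\<^sup>2 + q) / (1 + q)"
          "axial_solution q k \<tau>"
        unfolding sys by blast
      then show "(\<exists>!P. has_sqdists v P X Y Y Y) \<and>
           (\<forall>P. has_sqdists v P X Y Y Y \<longrightarrow>
              (\<not> (\<eta> = 12/5 \<and> X = 0) \<longrightarrow> geometrically_admissible v (sqrt (k / (4 * (1 + q)))) P) \<and>
              \<not> (\<exists>c. body_configuration v (sqrt (k / (4 * (1 + q)))) P c))"
        by (intro nonbody)
    qed
  qed
qed

end
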